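(* Let $K=\mathbf{Q}(\sqrt{-1})$ and let $1/4<\alpha<1/3$. Let $N(r)$ be the cardinality of $\{(x,y)\in\mathbf{Z}^2 : x^2+y^2\le r\}$. Then \[N(r)=\pi r+O(r^{\alpha})\] holds if and only if for all integers $m\ge 2$, \[E_m(x,K)=\begin{cases} O(x^{m-1+\alpha}) & \text{if } m\ge 3,\\ O(x^{1+\alpha}\log x) & \text{if } m=2,\end{cases}\] where $E_m(x,K)=V_m(x,K)-\dfrac{(\pi x/4)^m}{\zeta_K(m)}$.
   Context: Here $\mathcal{O}_K=\mathbf{Z}[\sqrt{-1}]$ and $\mathfrak{N}\mathfrak{a}$ is the absolute norm of an ideal. An $m$-tuple $(\mathfrak{a}_1,\ldots,\mathfrak{a}_m)$ of nonzero ideals of $\mathcal{O}_K$ is called visible (from the origin) if $\mathfrak{a}_1+\cdots+\mathfrak{a}_m=\mathcal{O}_K$. $V_m(x,K)$ is the number of visible $m$-tuples with $\mathfrak{N}\mathfrak{a}_i\le x$ for all $i$. $\zeta_K(s)=\sum_{\mathfrak{a}}\mathfrak{N}\mathfrak{a}^{-s}$ is the Dedekind zeta function of $K$ (sum over nonzero ideals). The constant $\pi/4$ is the residue of $\zeta_K$ at $s=1$ for this $K$. *)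

theory Defs
  imports
    "HOL-Analysis.Analysis"
    "HOL-Library.Landau_Symbols"
    "HOL-Algebra.QuotRing"
begin

definition gaussian_integers :: "complex ring" where
  "gaussian_integers =
     \<lparr>carrier = {of_int a + \<i> * of_int b | a b. True},
      mult = (*), one = 1, zero = 0, add = (+)\<rparr>"

lemma cring_gaussian_integers: "cring gaussian_integers"
proof (rule cringI)
  let ?G = "gaussian_integers"
  have mem: "z \<in> carrier ?G \<longleftrightarrow> Re z \<in> \<int> \<and> Im z \<in> \<int>" for z
    by (auto simp: gaussian_integers_def complex_eq_iff elim!: Ints_cases)
  show "abelian_group ?G"
  proof (rule abelian_groupI)
    fix z assume "z \<in> carrier ?G"
    then have "- z \<in> carrier ?G" "- z \<oplus>\<^bsub>?G\<^esub> z = \<zero>\<^bsub>?G\<^esub>"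
      by (auto simp: mem) (simp add: gaussian_integers_def)
    then show "\<exists>w\<in>carrier ?G. w \<oplus>\<^bsub>?G\<^esub> z = \<zero>\<^bsub>?G\<^esub>" by blast
  qed (auto simp: mem, auto simp: gaussian_integers_def)
  show "comm_monoid ?G"
    by (rule comm_monoidI) (auto simp: mem, auto simp: gaussian_integers_def)
qed (auto simp: gaussian_integers_def algebra_simps)

definition nonzero_ideals :: "('a, 'b) ring_scheme \<Rightarrow> 'a set set" where
  "nonzero_ideals R = {I. ideal I R \<and> I \<noteq> {\<zero>\<^bsub>R\<^esub>}}"

text \<open>
  The absolute norm is the index of the ideal. It is only meaningful for ideals of finite index;
  in the ring of integers of a number field these are exactly the nonzero ideals.
\<close>

definition ideal_norm :: "('a, 'b) ring_scheme \<Rightarrow> 'a set \<Rightarrow> nat" where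
  "ideal_norm R I = card (carrier (R Quot I))"

definition visible :: "('a, 'b) ring_scheme \<Rightarrow> 'a set list \<Rightarrow> bool" where
  "visible R Is \<longleftrightarrow> foldr (set_add R) Is {\<zero>\<^bsub>R\<^esub>} = carrier R"

definition visible_count :: "('a, 'b) ring_scheme \<Rightarrow> nat \<Rightarrow> real \<Rightarrow> nat" where
  "visible_count R m x =
     card {Is. length Is = m \<and> set Is \<subseteq> nonzero_ideals R \<and> visible R Is \<and>
               (\<forall>I\<in>set Is. real (ideal_norm R I) \<le> x)}"

text \<open>
  The Dirichlet series of the Dedekind zeta function at a real argument; it represents the
  zeta function for \<open>s > 1\<close>, which is the only range used here.
\<close>

definition dedekind_zeta :: "('a, 'b) ring_scheme \<Rightarrow> real \<Rightarrow> real" where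
  "dedekind_zeta R s = (\<Sum>\<^sub>\<infinity>I\<in>nonzero_ideals R. real (ideal_norm R I) powr (- s))"

text \<open>
  The error term for the field of Gaussian numbers, where \<open>\<pi> / 4\<close> is the residue at 1 of the
  Dedekind zeta function.
\<close>

definition visible_error :: "nat \<Rightarrow> real \<Rightarrow> real" where
  "visible_error m x =
     real (visible_count gaussian_integers m x)
       - (pi * x / 4) ^ m / dedekind_zeta gaussian_integers (real m)"

definition circle_count :: "real \<Rightarrow> nat" where
  "circle_count r = card {(x :: int, y :: int). real_of_int (x\<^sup>2 + y\<^sup>2) \<le> r}"

end

theory Submission
  imports
    Defs
    "HOL-Computational_Algebra.Squarefree"
    "HOL-Computational_Algebra.Euclidean_Algorithm"
begin

text \<open>
  Write \<open>I(x)\<close> for the number of nonzero ideals of norm at most \<open>x\<close>. Counting generators, which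
  are unique up to the four units, shows that the disc contains \<open>4 I(x) + 1\<close> lattice points.
  Factoring out the common divisor of an \<open>m\<close>-tuple yields \<open>I(x)\<^sup>m = \<Sum> V\<^sub>m(x / N(d))\<close> over the
  nonzero ideals \<open>d\<close> with norm \<open>N(d)\<close>, and Moebius inversion turns this into
  \<open>V\<^sub>m(x) = \<Sum> \<mu>(d) I(x / N(d))\<^sup>m\<close>. Both sums transport an asymptotic \<open>A y\<^sup>m + O(y\<^sup>b)\<close> with
  \<open>1 < b \<le> m\<close>, since \<open>\<Sum> N(d)\<^sup>-\<^sup>b\<close> converges; here \<open>b = m - 1 + \<alpha>\<close>. For the converse the single
  case \<open>m = 3\<close> suffices, and \<open>I(x)\<close> is recovered from its \<open>m\<close>-th power.
\<close>

subsection \<open>The Gaussian integers\<close>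

text \<open>The ideals live in the algebraic structure \<open>gaussian_integers\<close>, whereas
  unique factorization, gcds and normal associates come with type classes. The type
  \<open>gauss\<close> is therefore made a Euclidean ring and linked to that carrier by
  \<open>of_gauss\<close>, so that counting ideals becomes counting normalized generators. The
  analytic obstacle is that a big-O says nothing about small arguments, while the convolution sums
  evaluate the counting function at x / N(d) for all N(d) <= x, hence anywhere in [1, x]. The bounds
  must be made uniform on [1, infinity), and the tail N(d) > x of the main-term series is absorbed
  by y^m <= y^b for y <= 1. Since b = 1 + \<alpha> exceeds 1 even for m = 2, no logarithm arises in
  passing from ideals to visible tuples.\<close>

datatype gauss = Gauss (re: int) (im: int)

instantiation gauss :: comm_ring_1
begin

definition "0 = Gauss 0 0"
definition "1 = Gauss 1 0"
definition "z + w = Gauss (re z + re w) (im z + im w)"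
definition "z - w = Gauss (re z - re w) (im z - im w)"
definition "- z = Gauss (- re z) (- im z)"
definition "z * w = Gauss (re z * re w - im z * im w) (re z * im w + im z * re w)"

instance
  by standard
    (auto simp: zero_gauss_def one_gauss_def plus_gauss_def minus_gauss_def
      uminus_gauss_def times_gauss_def algebra_simps)

end

lemma gauss_sel [simp]:
  "re 0 = 0" "im 0 = 0" "re 1 = 1" "im 1 = 0"
  "re (z + w) = re z + re w" "im (z + w) = im z + im w"
  "re (z - w) = re z - re w" "im (z - w) = im z - im w"
  "re (- z) = - re z" "im (- z) = - im z"
  "re (z * w) = re z * re w - im z * im w" "im (z * w) = re z * im w + im z * re w"
  by (simp_all add: zero_gauss_def one_gauss_def plus_gauss_def minus_gauss_def
      uminus_gauss_def times_gauss_def)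

lemma gauss_eq_iff: "z = w \<longleftrightarrow> re z = re w \<and> im z = im w"
  by (auto intro: gauss.expand)

definition gnorm :: "gauss \<Rightarrow> nat" where
  "gnorm z = nat ((re z)\<^sup>2 + (im z)\<^sup>2)"

lemma int_gnorm: "int (gnorm z) = (re z)\<^sup>2 + (im z)\<^sup>2"
  by (simp add: gnorm_def)

lemma gnorm_mult: "gnorm (z * w) = gnorm z * gnorm w"
proof -
  have "int (gnorm (z * w)) = int (gnorm z * gnorm w)"
    by (simp add: int_gnorm power2_eq_square algebra_simps)
  then show ?thesis by (simp only: of_nat_eq_iff)
qed

lemma gnorm_eq_0_iff [simp]: "gnorm z = 0 \<longleftrightarrow> z = 0"
proof -
  have "gnorm z = 0 \<longleftrightarrow> int (gnorm z) = 0" by simp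
  also have "\<dots> \<longleftrightarrow> z = 0" by (simp add: int_gnorm gauss_eq_iff sum_power2_eq_zero_iff)
  finally show ?thesis .
qed

lemma gnorm_0 [simp]: "gnorm 0 = 0" and gnorm_1 [simp]: "gnorm 1 = 1"
  by simp (simp add: gnorm_def)

lemma gnorm_pos: "z \<noteq> 0 \<Longrightarrow> 1 \<le> gnorm z"
  using gnorm_eq_0_iff[of z] by linarith

section \<open>Embedding into the complex numbers and Euclidean division\<close>

definition of_gauss :: "gauss \<Rightarrow> complex" where
  "of_gauss z = Complex (of_int (re z)) (of_int (im z))"

lemma of_gauss_simps [simp]:
  "of_gauss 0 = 0" "of_gauss 1 = 1" "of_gauss (z + w) = of_gauss z + of_gauss w"
  "of_gauss (z - w) = of_gauss z - of_gauss w" "of_gauss (- z) = - of_gauss z"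
  "of_gauss (z * w) = of_gauss z * of_gauss w"
  by (simp_all add: of_gauss_def complex_eq_iff)

lemma of_gauss_eq_iff [simp]: "of_gauss z = of_gauss w \<longleftrightarrow> z = w"
  by (simp add: of_gauss_def gauss_eq_iff)

lemma of_gauss_eq_0_iff [simp]: "of_gauss z = 0 \<longleftrightarrow> z = 0"
  using of_gauss_eq_iff[of z 0] by (simp del: of_gauss_eq_iff)

lemma gnorm_cmod: "real (gnorm z) = (cmod (of_gauss z))\<^sup>2"
proof -
  have "real (gnorm z) = real_of_int (int (gnorm z))" by simp
  then show ?thesis unfolding int_gnorm by (simp add: cmod_power2 of_gauss_def)
qed

text \<open>Division rounds both coordinates of the complex quotient. The normal associate of a
  nonzero z is the one in the half-open quadrant re > 0, im >= 0, and \<open>unit_factor z\<close>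
  is the power of i that rotates this quadrant onto the one containing z.\<close>

instantiation gauss :: "{idom_modulo, normalization_euclidean_semiring}"
begin

definition "z div w = (let q = of_gauss z / of_gauss w in Gauss (round (Re q)) (round (Im q)))"
definition "z mod w = z - z div w * (w :: gauss)"
definition "euclidean_size = gnorm"
definition "unit_factor z =
  (if re z > 0 \<and> im z \<ge> 0 then 1
   else if re z \<le> 0 \<and> im z > 0 then Gauss 0 1
   else if re z < 0 \<and> im z \<le> 0 then -1
   else if re z \<ge> 0 \<and> im z < 0 then Gauss 0 (-1)
   else 0)"
definition "normalize z =
  (if re z > 0 \<and> im z \<ge> 0 then z
   else if re z \<le> 0 \<and> im z > 0 then Gauss 0 (-1) * z
   else if re z < 0 \<and> im z \<le> 0 then - z
   else if re z \<ge> 0 \<and> im z < 0 then Gauss 0 1 * z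
   else 0)"

lemma gnorm_eq_1E:
  assumes "gnorm z = 1"
  shows "z \<in> {1, -1, Gauss 0 1, Gauss 0 (-1)}"
proof -
  have 1: "(re z)\<^sup>2 + (im z)\<^sup>2 = 1" using int_gnorm[of z] assms by simp
  have "\<bar>re z\<bar> < 2" "\<bar>im z\<bar> < 2"
    using 1 power2_less_imp_less[of "\<bar>re z\<bar>" 2] power2_less_imp_less[of "\<bar>im z\<bar>" 2]
      zero_le_power2[of "re z"] zero_le_power2[of "im z"] by simp_all
  then have "re z \<in> {-1, 0, 1}" "im z \<in> {-1, 0, 1}" by auto
  with 1 show ?thesis by (auto simp: gauss_eq_iff)
qed

lemma gauss_dvd_1_iff: "(z :: gauss) dvd 1 \<longleftrightarrow> z \<in> {1, -1, Gauss 0 1, Gauss 0 (-1)}"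
proof
  assume "z dvd 1"
  then obtain w where "1 = z * w" by (auto simp: dvd_def)
  then have "gnorm z * gnorm w = 1" by (metis gnorm_1 gnorm_mult)
  then show "z \<in> {1, -1, Gauss 0 1, Gauss 0 (-1)}" by (intro gnorm_eq_1E) simp
next
  have "1 = Gauss 0 1 * Gauss 0 (-1)" "1 = Gauss 0 (-1) * Gauss 0 1" by (simp_all add: gauss_eq_iff)
  then have "Gauss 0 1 dvd 1" "Gauss 0 (-1) dvd 1" using dvdI by blast+
  then show "z \<in> {1, -1, Gauss 0 1, Gauss 0 (-1)} \<Longrightarrow> z dvd 1" by auto
qed

text \<open>Rounding moves each coordinate of the exact quotient by at most 1/2, so the error r
  satisfies |r|^2 <= 1/4 + 1/4 < 1, and the remainder is r times w.\<close>

lemma gnorm_diff_div_less: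
  assumes "w \<noteq> 0"
  shows "gnorm (z - z div w * w) < gnorm w"
proof -
  define q where "q = of_gauss z / of_gauss w"
  define r where "r = q - of_gauss (z div w)"
  have w: "cmod (of_gauss w) > 0" using assms by simp
  have "\<bar>Re r\<bar> \<le> 1/2" "\<bar>Im r\<bar> \<le> 1/2"
    using of_int_round_abs_le[of "Re q"] of_int_round_abs_le[of "Im q"]
    by (simp_all add: r_def divide_gauss_def Let_def of_gauss_def q_def abs_minus_commute)
  then have "(Re r)\<^sup>2 \<le> (1/2)\<^sup>2" "(Im r)\<^sup>2 \<le> (1/2)\<^sup>2" by (metis abs_ge_zero power2_abs power_mono)+
  then have "(cmod r)\<^sup>2 < 1" by (simp only: cmod_power2) (simp add: power2_eq_square)
  moreover have "of_gauss (z - z div w * w) = r * of_gauss w"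
    using assms by (simp add: r_def q_def field_simps)
  ultimately have "real (gnorm (z - z div w * w)) < real (gnorm w)"
    using w unfolding gnorm_cmod by (simp add: norm_mult power_mult_distrib)
  then show ?thesis by simp
qed

instance
proof
  fix a b c :: gauss
  show "a \<noteq> 0 \<Longrightarrow> b \<noteq> 0 \<Longrightarrow> a * b \<noteq> 0"
    using gnorm_mult[of a b] gnorm_eq_0_iff by fastforce
  show "b \<noteq> 0 \<Longrightarrow> a * b div b = a"
    by (simp add: divide_gauss_def) (simp add: of_gauss_def)
  show "a div 0 = 0"
    by (simp add: divide_gauss_def gauss_eq_iff)
  show "a div b * b + a mod b = a"
    by (simp add: modulo_gauss_def)
  show "euclidean_size (0 :: gauss) = 0"
    by (simp add: euclidean_size_gauss_def)
  show "b \<noteq> 0 \<Longrightarrow> euclidean_size (a mod b) < euclidean_size b"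
    by (simp add: euclidean_size_gauss_def modulo_gauss_def gnorm_diff_div_less)
  show "b \<noteq> 0 \<Longrightarrow> euclidean_size a \<le> euclidean_size (a * b)"
    using gnorm_pos[of b] by (simp add: euclidean_size_gauss_def gnorm_mult)
  show "unit_factor (0::gauss) = 0" "normalize (0::gauss) = 0"
    by (simp_all add: unit_factor_gauss_def normalize_gauss_def)
  show "a dvd 1 \<Longrightarrow> unit_factor a = a"
    by (auto simp: gauss_dvd_1_iff unit_factor_gauss_def)
  show "a \<noteq> 0 \<Longrightarrow> unit_factor a dvd 1"
    unfolding gauss_dvd_1_iff unit_factor_gauss_def gauss_eq_iff by simp linarith
  show "unit_factor (a * b) = a * unit_factor b" if "a dvd 1"
  proof -
    \<comment> \<open>The four half-open quadrants and the origin partition the plane and the units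
      permute the quadrants, which leaves a finite check.\<close>
    consider "re b > 0" "im b \<ge> 0" | "re b \<le> 0" "im b > 0" | "re b < 0" "im b \<le> 0"
      | "re b \<ge> 0" "im b < 0" | "re b = 0" "im b = 0" by linarith
    moreover have "a = 1 \<or> a = -1 \<or> a = Gauss 0 1 \<or> a = Gauss 0 (-1)"
      using that by (simp add: gauss_dvd_1_iff)
    ultimately show ?thesis
      by cases (elim disjE; simp add: unit_factor_gauss_def gauss_eq_iff)+
  qed
  show "unit_factor a * normalize a = a"
    unfolding unit_factor_gauss_def normalize_gauss_def gauss_eq_iff by simp linarith
qed

end

instance gauss :: euclidean_ring ..

lemma gnorm_unit: "z dvd 1 \<Longrightarrow> gnorm z = 1"
  by (auto simp: gauss_dvd_1_iff gnorm_def)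

lemma gnorm_normalize [simp]: "gnorm (normalize z) = gnorm z"
  using gnorm_mult[of "unit_factor z" "normalize z"] gnorm_unit[of "unit_factor z"]
  by (cases "z = 0") auto

lemma gnorm_dvd_le: "d dvd z \<Longrightarrow> z \<noteq> 0 \<Longrightarrow> gnorm d \<le> gnorm z"
  using gnorm_pos by (force simp: dvd_def gnorm_mult)

subsection \<open>Ideals and the Moebius function\<close>

text \<open>The Moebius function of the ideal (d): squarefreeness and the set of normalized prime
  factors depend only on the associate class.\<close>

definition moebius :: "'a :: factorial_semiring \<Rightarrow> real" where
  "moebius d = (if squarefree d then (-1) ^ card (prime_factors d) else 0)"

lemma abs_moebius_le: "\<bar>moebius d\<bar> \<le> 1"
  by (simp add: moebius_def)

text \<open>A normalized divisor is determined by its prime factorization, which is a submultiset of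
  that of k.\<close>

lemma finite_normalized_divisors:
  fixes k :: "'a :: factorial_semiring"
  assumes "k \<noteq> 0"
  shows "finite {d. normalize d = d \<and> d dvd k}"
proof (rule finite_imageD)
  let ?D = "{d. normalize d = d \<and> d dvd k}"
  have 0: "d \<noteq> 0" if "d \<in> ?D" for d using that assms by auto
  show "inj_on prime_factorization ?D"
  proof (rule inj_onI)
    fix d e assume "d \<in> ?D" "e \<in> ?D" "prime_factorization d = prime_factorization e"
    with 0 have "normalize d = normalize e" by (subst prime_factorization_unique [symmetric]) auto
    with \<open>d \<in> ?D\<close> \<open>e \<in> ?D\<close> show "d = e" by simp
  qed
  let ?M = "\<Union>n\<le>size (prime_factorization k). multisets_of_size (prime_factors k) n"
  have "prime_factorization d \<in> ?M" if "d \<in> ?D" for d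
  proof -
    have "prime_factorization d \<subseteq># prime_factorization k"
      using that 0[OF that] assms by (subst prime_factorization_subset_iff_dvd) auto
    then show ?thesis
      by (auto simp: multisets_of_size_def dest: set_mset_mono size_mset_mono)
  qed
  then have "prime_factorization ` ?D \<subseteq> ?M" by blast
  then show "finite (prime_factorization ` ?D)" by (rule finite_subset) auto
qed

lemma prime_factorization_prod_primes:
  assumes "finite P" "\<And>p. p \<in> P \<Longrightarrow> prime p"
  shows "prime_factorization (\<Prod>P :: 'a :: factorial_semiring) = mset_set P"
  using prime_factorization_prod_mset_primes[of "mset_set P"] assms
  by (simp add: prod_unfold_prod_mset)

lemma squarefree_iff_prime_factorization:
  fixes d :: "'a :: factorial_semiring"
  assumes "d \<noteq> 0"
  shows "squarefree d \<longleftrightarrow> prime_factorization d = mset_set (prime_factors d)"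
proof -
  have "squarefree d \<longleftrightarrow> (\<forall>p\<in>prime_factors d. count (prime_factorization d) p = 1)"
    using assms by (auto simp: squarefree_factorial_semiring' count_prime_factorization)
  also have "\<dots> \<longleftrightarrow> prime_factorization d = mset_set (prime_factors d)"
    by (auto simp: multiset_eq_iff count_mset_set' not_in_iff)
  finally show ?thesis .
qed

text \<open>Only squarefree divisors contribute, and up to associates these are the products of the
  sets P of prime factors of k. The sum of (-1)^|P| over all such P expands a product of factors 1 -
  1, which vanishes unless it is empty, that is, unless k is a unit.\<close>

lemma sum_moebius:
  fixes k :: "'a :: factorial_semiring"
  assumes k: "k \<noteq> 0"
  shows "(\<Sum>d | normalize d = d \<and> d dvd k. moebius d) = (if is_unit k then 1 else 0)"
proof -
  let ?D = "{d. normalize d = d \<and> d dvd k}"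
  let ?S = "{d. normalize d = d \<and> d dvd k \<and> squarefree d}"
  have fin: "finite P" and prime: "\<And>p. p \<in> P \<Longrightarrow> prime p"
    if "P \<subseteq> prime_factors k" for P
    using that finite_subset[OF that] by (auto simp: prime_factors_dvd)
  have pf: "prime_factorization (normalize (\<Prod>P)) = mset_set P" if "P \<subseteq> prime_factors k" for P
    using prime_factorization_prod_primes[OF fin[OF that] prime[OF that]] by simp
  have nz: "\<Prod>P \<noteq> 0" if "P \<subseteq> prime_factors k" for P
    using fin[OF that] prime[OF that, of 0] by (auto simp: prod_zero_iff)
  have "(\<Sum>d\<in>?D. moebius d) = (\<Sum>d\<in>?S. (-1) ^ card (prime_factors d))"
    using finite_normalized_divisors[OF k]
    by (intro sum.mono_neutral_cong_right) (auto simp: moebius_def)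
  also have "\<dots> = (\<Sum>P\<in>Pow (prime_factors k). (-1) ^ card P)"
  proof (rule sum.reindex_bij_witness[where j = prime_factors and i = "\<lambda>P. normalize (\<Prod>P)"])
    fix d assume d: "d \<in> ?S"
    then have d0: "d \<noteq> 0" by auto
    have "d dvd k" using d by auto
    then have "prime_factorization d \<subseteq># prime_factorization k"
      using d0 k prime_factorization_subset_iff_dvd by blast
    then show sub: "prime_factors d \<in> Pow (prime_factors k)" using set_mset_mono by auto
    have "prime_factorization (normalize (\<Prod>(prime_factors d))) = prime_factorization d"
      using pf[of "prime_factors d"] sub d squarefree_iff_prime_factorization[OF d0] by simp
    then have "normalize (normalize (\<Prod>(prime_factors d))) = normalize d"
      using nz[of "prime_factors d"] sub d0 by (subst prime_factorization_unique [symmetric]) auto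
    then show "normalize (\<Prod>(prime_factors d)) = d" using d by simp
  next
    fix P assume "P \<in> Pow (prime_factors k)"
    then have P: "P \<subseteq> prime_factors k" by simp
    have pfs: "prime_factors (normalize (\<Prod>P)) = P"
      unfolding pf[OF P] using fin[OF P] by simp
    then show "prime_factors (normalize (\<Prod>P)) = P" .
    have "mset_set P \<subseteq># prime_factorization k"
      using P fin[OF P] count_greater_zero_iff[of "prime_factorization k"]
      by (auto simp: subseteq_mset_def count_mset_set' Suc_le_eq)
    then have "normalize (\<Prod>P) dvd k"
      using nz[OF P] k pf[OF P] by (subst prime_factorization_subset_iff_dvd [symmetric]) simp_all
    moreover have "squarefree (normalize (\<Prod>P))"
      using nz[OF P] pf[OF P] pfs by (subst squarefree_iff_prime_factorization) simp_all
    ultimately show "normalize (\<Prod>P) \<in> ?S" by simp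
  qed auto
  also have "\<dots> = (\<Prod>p\<in>prime_factors k. 1 - (1 :: real))"
    using prod_diff_conv_sum[of "prime_factors k" "\<lambda>_. 1 :: real" "\<lambda>_. 1"] by simp
  also have "\<dots> = (if is_unit k then 1 else 0)"
    using k by (auto simp: prime_factorization_empty_iff prod_constant power_0_left card_eq_0_iff)
  finally show ?thesis .
qed

section \<open>Ideals of the Gaussian integers and their generators\<close>

lemma euclidean_ring_principal:
  fixes J :: "'a :: euclidean_ring set"
  assumes 0: "0 \<in> J" and add: "\<And>u v. u \<in> J \<Longrightarrow> v \<in> J \<Longrightarrow> u + v \<in> J"
    and mult: "\<And>u c. u \<in> J \<Longrightarrow> c * u \<in> J"
  shows "\<exists>h. J = {w. h dvd w}"
proof (cases "J = {0}")
  case False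
  then obtain u where u: "u \<in> J" "u \<noteq> 0" using 0 by auto
  \<comment> \<open>A nonzero element of least Euclidean size generates J: the remainder of any
    member modulo h lies in J and is smaller than h, hence is zero.\<close>
  obtain h where h: "h \<in> J" "h \<noteq> 0"
    and min: "\<And>v. v \<in> J \<Longrightarrow> v \<noteq> 0 \<Longrightarrow> euclidean_size h \<le> euclidean_size v"
    using ex_has_least_nat[of "\<lambda>v. v \<in> J \<and> v \<noteq> 0" u euclidean_size] u by blast
  have "h dvd w" if "w \<in> J" for w
  proof (rule ccontr)
    assume "\<not> h dvd w"
    then have nz: "w mod h \<noteq> 0" by (simp add: dvd_eq_mod_eq_0)
    have "w mod h = w + - (w div h) * h" by (simp add: minus_div_mult_eq_mod [symmetric])
    then have "w mod h \<in> J" using add[OF that mult[OF h(1), of "- (w div h)"]] by simp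
    with min nz have "euclidean_size h \<le> euclidean_size (w mod h)" by blast
    then show False using mod_size_less[OF h(2), of w] by simp
  qed
  moreover have "w \<in> J" if "h dvd w" for w
    using that mult[OF h(1)] by (auto simp: dvd_def mult.commute)
  ultimately show ?thesis by blast
qed (auto intro: exI[of _ 0])

definition gideal :: "gauss \<Rightarrow> complex set" where
  "gideal z = of_gauss ` {w. z dvd w}"

lemma carrier_gaussian_integers: "carrier gaussian_integers = range of_gauss"
proof -
  have "z \<in> range of_gauss" if "z = of_int a + \<i> * of_int b" for z a b
    using that by (intro image_eqI[of _ _ "Gauss a b"]) (auto simp: of_gauss_def complex_eq_iff)
  moreover have "of_gauss z = of_int (re z) + \<i> * of_int (im z)" for z
    by (auto simp: of_gauss_def complex_eq_iff)
  ultimately show ?thesis by (auto simp: gaussian_integers_def)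
qed

lemma gaussian_integers_sel [simp]:
  "monoid.mult gaussian_integers = (*)" "one gaussian_integers = 1"
  "zero gaussian_integers = 0" "add gaussian_integers = (+)"
  by (simp_all add: gaussian_integers_def)

lemma a_inv_gaussian_integers: "a_inv gaussian_integers (of_gauss z) = - of_gauss z"
proof -
  interpret cring gaussian_integers by (rule cring_gaussian_integers)
  show ?thesis
    by (rule minus_equality) (auto simp: carrier_gaussian_integers simp flip: of_gauss_simps)
qed

lemma of_gauss_in_gideal [simp]: "of_gauss w \<in> gideal z \<longleftrightarrow> z dvd w"
  by (auto simp: gideal_def)

lemma ideal_gideal: "ideal (gideal z) gaussian_integers"
proof (rule idealI)
  interpret cring gaussian_integers by (rule cring_gaussian_integers)
  show "ring gaussian_integers" by (rule ring_axioms)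
  show "subgroup (gideal z) (add_monoid gaussian_integers)"
  proof (rule subgroup.intro)
    fix x assume "x \<in> gideal z"
    then obtain w where w: "x = of_gauss w" "z dvd w" by (auto simp: gideal_def)
    then have "inv\<^bsub>add_monoid gaussian_integers\<^esub> x = of_gauss (- w)"
      using a_inv_gaussian_integers[of w] by (simp add: a_inv_def)
    then show "inv\<^bsub>add_monoid gaussian_integers\<^esub> x \<in> gideal z"
      using w by (simp del: of_gauss_simps)
  qed (auto simp: carrier_gaussian_integers gideal_def simp flip: of_gauss_simps)
qed (auto simp: carrier_gaussian_integers gideal_def simp flip: of_gauss_simps)

lemma ideal_eq_gideal:
  assumes "ideal I gaussian_integers"
  shows "\<exists>h. I = gideal h"
proof -
  interpret ideal I gaussian_integers by fact
  have "0 \<in> I" using additive_subgroup.zero_closed[OF is_additive_subgroup] unfolding gaussian_integers_sel .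
  moreover have "u + v \<in> I" if "u \<in> I" "v \<in> I" for u v
    using additive_subgroup.a_closed[OF is_additive_subgroup that] unfolding gaussian_integers_sel .
  ultimately have "\<exists>h. {w. of_gauss w \<in> I} = {w. h dvd w}"
    using I_l_closed by (intro euclidean_ring_principal) (auto simp: carrier_gaussian_integers)
  then obtain h where "{w. of_gauss w \<in> I} = {w. h dvd w}" ..
  moreover have "I = of_gauss ` {w. of_gauss w \<in> I}"
    using a_subset by (auto simp: carrier_gaussian_integers)
  ultimately show ?thesis unfolding gideal_def by metis
qed

text \<open>Exactly one generator for each nonzero ideal; this is the index set of all sums over
  ideals below.\<close>

definition gauss_reps :: "gauss set" where
  "gauss_reps = {z. z \<noteq> 0 \<and> normalize z = z}"

lemma gideal_eq_iff: "gideal z = gideal w \<longleftrightarrow> normalize z = normalize w"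
proof
  assume "gideal z = gideal w"
  then have "z dvd w" "w dvd z" by (metis dvd_refl of_gauss_in_gideal)+
  then show "normalize z = normalize w" by (rule associatedI)
next
  assume "normalize z = normalize w"
  then have "z dvd u \<longleftrightarrow> w dvd u" for u by (metis normalize_dvd_iff)
  then show "gideal z = gideal w" by (simp add: gideal_def)
qed

lemma bij_betw_gideal: "bij_betw gideal gauss_reps (nonzero_ideals gaussian_integers)"
proof (rule bij_betw_imageI)
  show "inj_on gideal gauss_reps"
    by (auto intro!: inj_onI simp: gideal_eq_iff gauss_reps_def)
  have g0: "gideal 0 = {0}" by (simp add: gideal_def)
  have ne: "gideal z \<noteq> {0}" if "z \<noteq> 0" for z
    using that by (metis g0 gideal_eq_iff normalize_0 normalize_eq_0_iff)
  show "gideal ` gauss_reps = nonzero_ideals gaussian_integers"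
  proof
    show "gideal ` gauss_reps \<subseteq> nonzero_ideals gaussian_integers"
      using ne by (auto simp: nonzero_ideals_def ideal_gideal gauss_reps_def)
    show "nonzero_ideals gaussian_integers \<subseteq> gideal ` gauss_reps"
    proof
      fix I assume "I \<in> nonzero_ideals gaussian_integers"
      then have I: "ideal I gaussian_integers" "I \<noteq> {0}" by (auto simp: nonzero_ideals_def)
      obtain h where h: "I = gideal h" using ideal_eq_gideal[OF I(1)] ..
      have "I = gideal (normalize h)" unfolding h gideal_eq_iff by simp
      moreover have "normalize h \<in> gauss_reps" using h I(2) g0 by (auto simp: gauss_reps_def)
      ultimately show "I \<in> gideal ` gauss_reps" by blast
    qed
  qed
qed

text \<open>The generator h of the sum is a gcd: z and w lie in the sum, so h divides both, and h =
  u + v with z dividing u and w dividing v is divisible by every common divisor.\<close>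

lemma set_add_gideal:
  "\<exists>h. set_add gaussian_integers (gideal z) (gideal w) = gideal h \<and>
       (\<forall>d. d dvd h \<longleftrightarrow> d dvd z \<and> d dvd w)"
proof -
  interpret cring gaussian_integers by (rule cring_gaussian_integers)
  have eq: "set_add gaussian_integers (gideal z) (gideal w) =
      of_gauss ` {u + v | u v. z dvd u \<and> w dvd v}"
    by (force simp: set_add_def' gideal_def simp flip: of_gauss_simps(3))
  obtain h where h: "set_add gaussian_integers (gideal z) (gideal w) = gideal h"
    using ideal_eq_gideal[OF add_ideals[OF ideal_gideal[of z] ideal_gideal[of w]]] ..
  have mem: "h dvd x \<longleftrightarrow> (\<exists>u v. x = u + v \<and> z dvd u \<and> w dvd v)" for x
    using of_gauss_in_gideal[of x h] unfolding h [symmetric] eq image_iff by (simp del: of_gauss_simps)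
  have "h dvd z" "h dvd w" using mem by (metis add_0_right add_0_left dvd_refl dvd_0_right)+
  moreover obtain u v where "h = u + v" "z dvd u" "w dvd v" using mem[of h] by auto
  ultimately have "d dvd h \<longleftrightarrow> d dvd z \<and> d dvd w" for d
    by (metis dvd_trans dvd_add)
  with h show ?thesis by (intro exI[of _ h]) simp
qed

text \<open>Describing h by its divisors lets the induction start at the empty list, where h = 0 is
  divisible by everything.\<close>

lemma foldr_set_add_gideal:
  "\<exists>h. foldr (set_add gaussian_integers) (map gideal zs) {0} = gideal h \<and>
       (\<forall>d. d dvd h \<longleftrightarrow> (\<forall>z\<in>set zs. d dvd z))"
proof (induction zs)
  case Nil
  have "{0} = gideal 0" by (simp add: gideal_def)
  then show ?case by auto
next
  case (Cons z zs)
  then obtain h where h: "foldr (set_add gaussian_integers) (map gideal zs) {0} = gideal h \<and>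
    (\<forall>d. d dvd h \<longleftrightarrow> (\<forall>z\<in>set zs. d dvd z))" ..
  obtain h' where "set_add gaussian_integers (gideal z) (gideal h) = gideal h' \<and>
    (\<forall>d. d dvd h' \<longleftrightarrow> d dvd z \<and> d dvd h)" using set_add_gideal[of z h] ..
  with h show ?case by (intro exI[of _ h']) simp
qed

text \<open>The tuple is visible iff the gcd h of its entries is a unit, and
  \<open>sum_moebius\<close> detects this by a sum over the divisors of h, which are the common
  divisors of the entries. Nonemptiness gives h a nonzero entry to divide, so h is nonzero.\<close>

lemma visible_gideal:
  assumes "zs \<noteq> []" "set zs \<subseteq> gauss_reps"
  shows "of_bool (visible gaussian_integers (map gideal zs)) =
    (\<Sum>d | d \<in> gauss_reps \<and> (\<forall>z\<in>set zs. d dvd z). moebius d)"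
proof -
  obtain h where "foldr (set_add gaussian_integers) (map gideal zs) {0} = gideal h \<and>
    (\<forall>d. d dvd h \<longleftrightarrow> (\<forall>z\<in>set zs. d dvd z))" using foldr_set_add_gideal[of zs] ..
  then have h: "foldr (set_add gaussian_integers) (map gideal zs) {0} = gideal h"
    and dvd: "\<And>d. d dvd h \<longleftrightarrow> (\<forall>z\<in>set zs. d dvd z)" by simp_all
  have h0: "h \<noteq> 0"
  proof
    assume "h = 0"
    then have "\<forall>z\<in>set zs. 0 dvd z" using dvd[of 0] by simp
    then show False using assms by (cases zs) (auto simp: gauss_reps_def)
  qed
  have "carrier gaussian_integers = gideal 1" by (auto simp: carrier_gaussian_integers gideal_def)
  then have "visible gaussian_integers (map gideal zs) \<longleftrightarrow> is_unit h"
    by (simp add: visible_def h gideal_eq_iff normalize_1_iff)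
  moreover have "{d. d \<in> gauss_reps \<and> (\<forall>z\<in>set zs. d dvd z)} = {d. normalize d = d \<and> d dvd h}"
    using h0 unfolding dvd [symmetric] by (auto simp: gauss_reps_def)
  ultimately show ?thesis using sum_moebius[OF h0] by simp
qed

section \<open>The index of a principal ideal\<close>

lemma coset_gideal:
  "gideal z +>\<^bsub>gaussian_integers\<^esub> of_gauss t = of_gauss ` {w. z dvd w - t}"
proof -
  have "of_gauss w \<in> gideal z +>\<^bsub>gaussian_integers\<^esub> of_gauss t" if "z dvd w - t" for w
    using that unfolding a_r_coset_def' by (auto intro!: bexI[of _ "of_gauss (w - t)"] simp del: of_gauss_simps(4)) simp
  then show ?thesis
    unfolding a_r_coset_def' by (auto simp: gideal_def simp flip: of_gauss_simps)
qed

text \<open>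
  With \<open>z = g (a + b i)\<close> and \<open>a\<close>, \<open>b\<close> coprime, the lattice \<open>(z)\<close> has a basis consisting of
  \<open>g (a\<^sup>2 + b\<^sup>2)\<close> and some \<open>u + g i\<close>, so the rectangle below is a fundamental domain.
\<close>

lemma complete_residues:
  fixes z :: gauss
  assumes "z \<noteq> 0"
  obtains T where "card T = gnorm z" "\<And>w. \<exists>!t. t \<in> T \<and> z dvd w - t"
proof -
  define g where "g = gcd (re z) (im z)"
  have g: "g > 0" using assms by (auto simp: g_def gauss_eq_iff)
  obtain a b where a: "re z = g * a" and b: "im z = g * b" and cop: "coprime a b"
    unfolding g_def by (metis assms gauss_eq_iff gauss_sel(1,2) gcd_coprime_exists gcd_eq_0_iff mult.commute)
  define n where "n = a\<^sup>2 + b\<^sup>2"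
  have n: "n > 0" using cop by (auto simp: n_def sum_power2_gt_zero_iff)
  have N: "int (gnorm z) = (g * n) * g"
    by (simp add: int_gnorm a b n_def power2_eq_square algebra_simps)
  \<comment> \<open>Bezout coefficients yield a multiple of z whose imaginary part is exactly g, the
    smallest positive value possible by \<open>g_dvd\<close>.\<close>
  obtain s t where st: "a * t + b * s = 1" using cop
    by (metis bezout_int coprime_imp_gcd_eq_1 mult.commute)
  define u where "u = re (z * Gauss s t)"
  have ug: "z * Gauss s t = Gauss u g"
  proof -
    have "im (z * Gauss s t) = g * (a * t + b * s)" by (simp add: a b algebra_simps)
    then show ?thesis by (simp add: gauss_eq_iff u_def st)
  qed
  have zug: "z dvd Gauss u g" unfolding ug [symmetric] by simp
  \<comment> \<open>The cofactor is the conjugate of z / g.\<close>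
  have zgn: "z dvd Gauss (g * n) 0"
  proof
    show "Gauss (g * n) 0 = z * Gauss a (- b)"
      by (simp add: gauss_eq_iff a b n_def power2_eq_square algebra_simps)
  qed
  have g_dvd: "g dvd im w" if "z dvd w" for w
    using that by (auto simp: dvd_def a b) (metis distrib_left mult.assoc mult.left_commute)
  \<comment> \<open>A vanishing imaginary part means a * im c = - b * re c. Coprimality gives re c =
    a * k and im c = b * l, and cancelling a * b gives l = - k, whence x = g * n * k. Cancellation
    fails only if a or b is 0, but then n = 1 and divisibility by g is enough.\<close>
  have gn_dvd: "g * n dvd x" if "z dvd Gauss x 0" for x
  proof -
    obtain c where c: "Gauss x 0 = z * c" using \<open>z dvd Gauss x 0\<close> by (auto simp: dvd_def)
    have x: "x = g * (a * re c - b * im c)" and 0: "g * (a * im c + b * re c) = 0"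
      using c by (simp_all add: gauss_eq_iff a b algebra_simps)
    have 1: "a * im c = - (b * re c)" using 0 g by simp
    then have "a dvd b * re c" by (metis dvd_triv_left dvd_minus_iff)
    then have "a dvd re c" using cop coprime_dvd_mult_right_iff by blast
    then obtain k where k: "re c = a * k" by (auto simp: dvd_def)
    have "b dvd a * im c" using 1 by simp
    then have "b dvd im c" using cop coprime_dvd_mult_right_iff coprime_commute by blast
    then obtain l where l: "im c = b * l" by (auto simp: dvd_def)
    have "(a * b) * (l + k) = 0" using 1 by (simp add: k l algebra_simps)
    show ?thesis
    proof (cases "a * b = 0")
      case False
      then have "l = - k" using \<open>(a * b) * (l + k) = 0\<close> by simp
      then have "x = (g * n) * k" by (simp add: x k l n_def power2_eq_square algebra_simps)
      then show ?thesis by simp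
    next
      case True
      then consider "a = 0" "\<bar>b\<bar> = 1" | "b = 0" "\<bar>a\<bar> = 1" using cop by auto
      then have "n = 1" by cases (auto simp: n_def simp flip: power2_abs[of a] power2_abs[of b])
      then show ?thesis by (simp add: x)
    qed
  qed
  define T where "T = (\<lambda>(x, y). Gauss x y) ` ({0..<g * n} \<times> {0..<g})"
  have "card T = card ({0..<g * n} \<times> {0..<g})"
    unfolding T_def by (rule card_image) (auto intro: inj_onI)
  also have "\<dots> = gnorm z"
    using N g n by (simp add: nat_mult_distrib [symmetric])
  finally have card: "card T = gnorm z" .
  have "\<exists>!t. t \<in> T \<and> z dvd w - t" for w
  proof (rule ex_ex1I)
    \<comment> \<open>Subtracting q copies of the basis vector u + g i moves the imaginary part into
      [0, g); multiples of g n then reduce the real part.\<close>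
    define q where "q = im w div g"
    define v where "v = re w - q * u"
    define t where "t = Gauss (v mod (g * n)) (im w mod g)"
    have "w - t = Gauss q 0 * Gauss u g + Gauss (v div (g * n)) 0 * Gauss (g * n) 0"
    proof (rule gauss.expand, intro conjI)
      have "re (w - t) = q * u + (v - v mod (g * n))" by (simp add: t_def v_def)
      also have "v - v mod (g * n) = v div (g * n) * (g * n)" by (rule minus_mod_eq_div_mult)
      finally show "re (w - t) = re (Gauss q 0 * Gauss u g + Gauss (v div (g * n)) 0 * Gauss (g * n) 0)"
        by simp
      have "im (w - t) = im w - im w mod g" by (simp add: t_def)
      also have "\<dots> = q * g" unfolding q_def by (rule minus_mod_eq_div_mult)
      finally show "im (w - t) = im (Gauss q 0 * Gauss u g + Gauss (v div (g * n)) 0 * Gauss (g * n) 0)"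
        by simp
    qed
    then have "z dvd w - t" using zug zgn by (metis dvd_add dvd_mult)
    moreover have "t \<in> T" using g n by (auto simp: T_def t_def)
    ultimately show "\<exists>t. t \<in> T \<and> z dvd w - t" by blast
  next
    fix t t' assume t: "t \<in> T \<and> z dvd w - t" and t': "t' \<in> T \<and> z dvd w - t'"
    have dvd: "z dvd t - t'" using dvd_diff[of z "w - t'" "w - t"] t t' by simp
    have bd: "0 \<le> re t" "re t < g * n" "0 \<le> im t" "im t < g"
      "0 \<le> re t'" "re t' < g * n" "0 \<le> im t'" "im t' < g"
      using t t' by (auto simp: T_def)
    have *: "x = y" if "m dvd x - y" "0 \<le> x" "x < m" "0 \<le> y" "y < m" for x y m :: int
      using that by (metis mod_eq_dvd_iff mod_pos_pos_trivial)
    have im: "im t = im t'" using *[of g "im t" "im t'"] g_dvd[OF dvd] bd by simp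
    then have "t - t' = Gauss (re t - re t') 0" by (simp add: gauss_eq_iff)
    then have "re t = re t'" using *[of "g * n" "re t" "re t'"] gn_dvd[of "re t - re t'"] dvd bd by simp
    with im show "t = t'" by (simp add: gauss_eq_iff)
  qed
  with card show thesis by (rule that)
qed

text \<open>Cosets of (z) are images of residue classes modulo z, and the residue system T meets
  each class exactly once.\<close>

lemma ideal_norm_gideal:
  assumes "z \<noteq> 0"
  shows "ideal_norm gaussian_integers (gideal z) = gnorm z"
proof -
  obtain T where card: "card T = gnorm z" and T: "\<And>w. \<exists>!t. t \<in> T \<and> z dvd w - t"
    using complete_residues[OF assms] by blast
  define C where "C t = {w. z dvd w - t}" for t
  have eqv: "C t = C t' \<longleftrightarrow> z dvd t - t'" for t t'
  proof
    assume "C t = C t'"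
    moreover have "t \<in> C t" by (simp add: C_def)
    ultimately show "z dvd t - t'" by (auto simp: C_def)
  next
    assume z: "z dvd t - t'"
    have "z dvd w - t \<longleftrightarrow> z dvd w - t'" for w
      using dvd_add[OF _ z, of "w - t"] dvd_diff[OF _ z, of "w - t'"] by auto
    then show "C t = C t'" by (simp add: C_def)
  qed
  have "carrier (gaussian_integers Quot gideal z) = (`) of_gauss ` range C"
    by (auto simp: FactRing_def A_RCOSETS_def' carrier_gaussian_integers coset_gideal C_def)
  then have "ideal_norm gaussian_integers (gideal z) = card (range C)"
    unfolding ideal_norm_def by (simp add: card_image inj_image_eq_iff inj_def inj_on_def)
  also have "range C = C ` T" using T eqv by (auto simp: image_iff) metis
  also have "card (C ` T) = card T"
  proof (rule card_image, rule inj_onI)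
    fix t t' assume "t \<in> T" "t' \<in> T" "C t = C t'"
    then show "t = t'" using T[of t] eqv by (metis dvd_0_right diff_self)
  qed
  finally show ?thesis using card by simp
qed

subsection \<open>Counting ideals and visible tuples\<close>

text \<open>Its cardinality is \<open>I(x)\<close> in the notation of the overview.\<close>

definition reps_upto :: "real \<Rightarrow> gauss set" where
  "reps_upto x = {z \<in> gauss_reps. real (gnorm z) \<le> x}"

lemma finite_gnorm_le: "finite {z. real (gnorm z) \<le> x}"
proof (rule finite_subset)
  let ?n = "\<lfloor>x\<rfloor>"
  show "{z. real (gnorm z) \<le> x} \<subseteq> (\<lambda>(a, b). Gauss a b) ` ({-?n..?n} \<times> {-?n..?n})"
  proof
    fix z assume "z \<in> {z. real (gnorm z) \<le> x}"
    then have "int (gnorm z) \<le> ?n" by (simp add: le_floor_iff)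
    then have le: "(re z)\<^sup>2 + (im z)\<^sup>2 \<le> ?n" by (simp add: int_gnorm)
    have sq: "\<bar>a\<bar> \<le> a\<^sup>2" for a :: int
      using mult_left_mono[of 1 "\<bar>a\<bar>" "\<bar>a\<bar>"] by (cases "a = 0") (auto simp: power2_eq_square)
    have "\<bar>re z\<bar> \<le> ?n" "\<bar>im z\<bar> \<le> ?n"
      using le sq[of "re z"] sq[of "im z"] zero_le_power2[of "re z"] zero_le_power2[of "im z"] by linarith+
    then show "z \<in> (\<lambda>(a, b). Gauss a b) ` ({-?n..?n} \<times> {-?n..?n})"
      by (intro image_eqI[of _ _ "(re z, im z)"]) auto
  qed
qed simp

lemma finite_reps_upto [simp]: "finite (reps_upto x)"
  by (rule finite_subset[OF _ finite_gnorm_le[of x]]) (auto simp: reps_upto_def)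

lemma reps_upto_subset: "reps_upto x \<subseteq> gauss_reps"
  by (auto simp: reps_upto_def)

lemma gauss_reps_nonzero: "z \<in> gauss_reps \<Longrightarrow> z \<noteq> 0"
  by (simp add: gauss_reps_def)

lemma gauss_reps_iff: "z \<in> gauss_reps \<longleftrightarrow> re z > 0 \<and> im z \<ge> 0"
  by (auto simp: gauss_reps_def normalize_gauss_def gauss_eq_iff)

lemma normalize_in_gauss_reps [simp]: "normalize z \<in> gauss_reps \<longleftrightarrow> z \<noteq> 0"
  by (simp add: gauss_reps_def)

lemma gauss_units_reps: "z \<in> gauss_reps \<Longrightarrow> is_unit z \<longleftrightarrow> z = 1"
  using is_unit_normalize[of z] by (auto simp: gauss_reps_def)

text \<open>Every nonzero z factors uniquely into a unit and a normalized associate of the same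
  norm; the summand 1 is the origin, which lies in the disc because x >= 0.\<close>

lemma circle_count_eq:
  assumes "x \<ge> 0"
  shows "real (circle_count x) = 4 * real (card (reps_upto x)) + 1"
proof -
  let ?U = "{1, -1, Gauss 0 1, Gauss 0 (-1)}"
  let ?S = "{z. z \<noteq> 0 \<and> real (gnorm z) \<le> x}"
  have U: "u \<in> ?U \<longleftrightarrow> is_unit u" for u by (simp only: gauss_dvd_1_iff)
  have "bij_betw (\<lambda>(a, b). Gauss a b) {(a, b). real_of_int (a\<^sup>2 + b\<^sup>2) \<le> x} {z. real (gnorm z) \<le> x}"
  proof (rule bij_betw_byWitness[where f' = "\<lambda>z. (re z, im z)"])
    have "real (gnorm z) = real_of_int ((re z)\<^sup>2 + (im z)\<^sup>2)" for z
      using int_gnorm[of z] by (metis of_int_of_nat_eq)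
    then show "(\<lambda>(a, b). Gauss a b) ` {(a, b). real_of_int (a\<^sup>2 + b\<^sup>2) \<le> x} \<subseteq> {z. real (gnorm z) \<le> x}"
      "(\<lambda>z. (re z, im z)) ` {z. real (gnorm z) \<le> x} \<subseteq> {(a, b). real_of_int (a\<^sup>2 + b\<^sup>2) \<le> x}"
      by auto
  qed auto
  then have circ: "circle_count x = card {z. real (gnorm z) \<le> x}"
    unfolding circle_count_def by (rule bij_betw_same_card)
  have "bij_betw (\<lambda>(u, z). u * z) (?U \<times> reps_upto x) ?S"
  proof (rule bij_betw_byWitness[where f' = "\<lambda>z. (unit_factor z, normalize z)"])
    show "\<forall>p\<in>?U \<times> reps_upto x. (unit_factor (case p of (u, z) \<Rightarrow> u * z),
        normalize (case p of (u, z) \<Rightarrow> u * z)) = p"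
    proof (rule ballI)
      fix p assume "p \<in> ?U \<times> reps_upto x"
      then obtain u z where p: "p = (u, z)" and "u \<in> ?U" and z: "z \<in> reps_upto x" by (rule SigmaE)
      then have u: "is_unit u" unfolding U by simp
      have "normalize z = z" "z \<noteq> 0" using z by (auto simp: reps_upto_def gauss_reps_def)
      then have "unit_factor z = 1" by (metis mult_cancel_right mult_1_left unit_factor_mult_normalize)
      with u \<open>normalize z = z\<close> show "(unit_factor (case p of (u, z) \<Rightarrow> u * z),
          normalize (case p of (u, z) \<Rightarrow> u * z)) = p"
        by (simp add: p normalize_mult_unit_left)
    qed
    show "\<forall>z\<in>?S. (case (unit_factor z, normalize z) of (u, z) \<Rightarrow> u * z) = z" by simp
    show "(\<lambda>(u, z). u * z) ` (?U \<times> reps_upto x) \<subseteq> ?S"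
    proof (rule image_subsetI)
      fix p assume "p \<in> ?U \<times> reps_upto x"
      then obtain u z where p: "p = (u, z)" and "u \<in> ?U" and z: "z \<in> reps_upto x" by (rule SigmaE)
      then have u: "is_unit u" unfolding U by simp
      then have "u \<noteq> 0" by auto
      then show "(case p of (u, z) \<Rightarrow> u * z) \<in> ?S"
        using z gnorm_unit[OF u] by (auto simp: p reps_upto_def gauss_reps_def gnorm_mult)
    qed
    show "(\<lambda>z. (unit_factor z, normalize z)) ` ?S \<subseteq> ?U \<times> reps_upto x"
    proof (rule image_subsetI)
      fix z assume "z \<in> ?S"
      then show "(unit_factor z, normalize z) \<in> ?U \<times> reps_upto x"
        unfolding mem_Times_iff fst_conv snd_conv U by (simp add: reps_upto_def)
    qed
  qed
  then have "card ?S = card (?U \<times> reps_upto x)" by (rule bij_betw_same_card [symmetric])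
  also have "\<dots> = 4 * card (reps_upto x)"
    unfolding card_cartesian_product by (simp add: gauss_eq_iff)
  finally have S: "card ?S = 4 * card (reps_upto x)" .
  note circ
  also have "{z. real (gnorm z) \<le> x} = insert 0 ?S" using assms by auto
  also have "card \<dots> = Suc (card ?S)"
    using finite_subset[OF _ finite_gnorm_le[of x], of ?S] by (subst card_insert_disjoint) auto
  finally show ?thesis using S by simp
qed

text \<open>A product of representatives may leave the quadrant, as (1 + i)^2 = 2 i does, so ideals
  are multiplied by \<open>normalize (d * e)\<close>. Dividing by e then recovers d only up to a
  unit, which the outer \<open>normalize\<close> removes.\<close>

lemma normalize_mult_div:
  assumes "d \<in> gauss_reps" "e \<noteq> 0"
  shows "normalize (normalize (d * e) div e) = d"
proof -
  obtain u where u: "is_unit u" "normalize (d * e) = u * (d * e)"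
    by (metis associatedE1 normalize_idem)
  then have "normalize (d * e) div e = u * d" using assms(2) by (simp add: mult.assoc [symmetric])
  then show ?thesis using u assms(1) by (simp add: normalize_mult_unit_left gauss_reps_def)
qed

lemma normalize_div_mult:
  assumes "k \<in> gauss_reps" "e dvd k"
  shows "normalize (normalize (k div e) * e) = k"
proof -
  have "normalize (normalize (k div e) * e) = normalize (k div e * e)" by simp
  then show ?thesis using assms by (simp add: gauss_reps_def)
qed

lemma gnorm_div: "e dvd k \<Longrightarrow> e \<noteq> 0 \<Longrightarrow> real (gnorm (k div e)) = real (gnorm k) / real (gnorm e)"
  by (auto simp: dvd_def gnorm_mult)

text \<open>Division by d, followed by normalization, is a bijection that divides norms by
  N(d).\<close>

lemma card_multiples:
  assumes "d \<in> gauss_reps"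
  shows "card {z \<in> reps_upto x. d dvd z} = card (reps_upto (x / gnorm d))"
proof -
  have d: "d \<noteq> 0" and pos: "real (gnorm d) > 0"
    using assms gnorm_pos[of d] by (auto simp: gauss_reps_def)
  have "bij_betw (\<lambda>z. normalize (z div d)) {z \<in> reps_upto x. d dvd z} (reps_upto (x / gnorm d))"
  proof (rule bij_betw_byWitness[where f' = "\<lambda>w. normalize (w * d)"])
    show "\<forall>z\<in>{z \<in> reps_upto x. d dvd z}. normalize (normalize (z div d) * d) = z"
      using normalize_div_mult by (auto simp: reps_upto_def)
    show "\<forall>w\<in>reps_upto (x / gnorm d). normalize (normalize (w * d) div d) = w"
      using normalize_mult_div d by (auto simp: reps_upto_def)
    show "(\<lambda>z. normalize (z div d)) ` {z \<in> reps_upto x. d dvd z} \<subseteq> reps_upto (x / gnorm d)"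
      using d pos
      by (auto simp: reps_upto_def gnorm_div divide_right_mono gauss_reps_nonzero dvd_div_eq_0_iff)
    show "(\<lambda>w. normalize (w * d)) ` reps_upto (x / gnorm d) \<subseteq> {z \<in> reps_upto x. d dvd z}"
      using d pos by (auto simp: reps_upto_def gnorm_mult gauss_reps_nonzero field_simps)
  qed
  then show ?thesis by (rule bij_betw_same_card)
qed

section \<open>Visible tuples and Moebius inversion\<close>

definition visible_reps :: "nat \<Rightarrow> real \<Rightarrow> gauss list set" where
  "visible_reps m x = {zs. set zs \<subseteq> reps_upto x \<and> length zs = m \<and>
     visible gaussian_integers (map gideal zs)}"

lemma finite_visible_reps: "finite (visible_reps m x)"
  unfolding visible_reps_def
  by (rule finite_subset[OF _ finite_lists_length_eq[OF finite_reps_upto, of x m]]) auto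

lemma visible_count_eq: "visible_count gaussian_integers m x = card (visible_reps m x)"
proof -
  have "map gideal ` visible_reps m x = {Is. length Is = m \<and> set Is \<subseteq> nonzero_ideals gaussian_integers \<and>
      visible gaussian_integers Is \<and> (\<forall>I\<in>set Is. real (ideal_norm gaussian_integers I) \<le> x)}"
    (is "?L = ?R")
  proof
    show "?L \<subseteq> ?R"
      using bij_betwE[OF bij_betw_gideal]
      by (auto simp: visible_reps_def reps_upto_def ideal_norm_gideal gauss_reps_nonzero subset_iff)
    show "?R \<subseteq> ?L"
    proof
      fix Is assume Is: "Is \<in> ?R"
      then have "set Is \<subseteq> gideal ` gauss_reps"
        using bij_betw_imp_surj_on[OF bij_betw_gideal] by auto
      then have "Is \<in> map gideal ` lists gauss_reps" unfolding lists_image [symmetric] by auto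
      then obtain zs where zs: "set zs \<subseteq> gauss_reps" "Is = map gideal zs" by auto
      have "zs \<in> visible_reps m x"
        using Is zs
        by (auto simp: visible_reps_def reps_upto_def ideal_norm_gideal gauss_reps_nonzero subset_iff)
      then show "Is \<in> ?L" unfolding zs(2) by (rule imageI)
    qed
  qed
  moreover have "inj_on (map gideal) (visible_reps m x)"
  proof (rule inj_onI)
    fix zs ws assume "zs \<in> visible_reps m x" "ws \<in> visible_reps m x" "map gideal zs = map gideal ws"
    moreover from this have "inj_on gideal (set zs \<union> set ws)"
      using reps_upto_subset by (intro inj_on_subset[OF bij_betw_imp_inj_on[OF bij_betw_gideal]])
        (auto simp: visible_reps_def)
    ultimately show "zs = ws" by (simp add: inj_on_map_eq_map)
  qed
  ultimately show ?thesis
    unfolding visible_count_def using card_image[of "map gideal" "visible_reps m x"] by simp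
qed

text \<open>Replace the indicator of visibility by its Moebius sum and exchange summations: for
  fixed d, the tuples with all entries divisible by d are the m-tuples from a set of I(x / N(d))
  elements.\<close>

lemma visible_count_moebius:
  assumes "m > 0"
  shows "real (visible_count gaussian_integers m x) =
    (\<Sum>d\<in>reps_upto x. moebius d * real (card (reps_upto (x / gnorm d))) ^ m)"
proof -
  let ?L = "{zs. set zs \<subseteq> reps_upto x \<and> length zs = m}"
  have fin: "finite ?L" by (rule finite_lists_length_eq) simp
  have "real (visible_count gaussian_integers m x) =
      (\<Sum>zs\<in>?L. of_bool (visible gaussian_integers (map gideal zs)))"
  proof -
    have "visible_reps m x = ?L \<inter> {zs. visible gaussian_integers (map gideal zs)}"
      by (auto simp: visible_reps_def)
    then show ?thesis using fin unfolding visible_count_eq by simp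
  qed
  also have "\<dots> = (\<Sum>zs\<in>?L. \<Sum>d | d \<in> reps_upto x \<and> (\<forall>z\<in>set zs. d dvd z). moebius d)"
  proof (rule sum.cong)
    fix zs assume zs: "zs \<in> ?L"
    then have ne: "zs \<noteq> []" using assms by auto
    have sub: "set zs \<subseteq> gauss_reps" using zs reps_upto_subset by blast
    \<comment> \<open>A common divisor has norm at most that of the first entry, so d can range over
      a set that does not depend on the tuple.\<close>
    have "d \<in> reps_upto x" if "d \<in> gauss_reps" "\<forall>z\<in>set zs. d dvd z" for d
    proof -
      have hd: "hd zs \<in> reps_upto x" "d dvd hd zs" using ne zs that by auto
      then have "gnorm d \<le> gnorm (hd zs)" by (intro gnorm_dvd_le) (auto simp: reps_upto_def gauss_reps_def)
      then show ?thesis using hd(1) that(1) by (simp add: reps_upto_def)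
    qed
    then have "{d. d \<in> gauss_reps \<and> (\<forall>z\<in>set zs. d dvd z)} = {d. d \<in> reps_upto x \<and> (\<forall>z\<in>set zs. d dvd z)}"
      using reps_upto_subset by blast
    then show "of_bool (visible gaussian_integers (map gideal zs)) =
        (\<Sum>d | d \<in> reps_upto x \<and> (\<forall>z\<in>set zs. d dvd z). moebius d)"
      using visible_gideal[OF ne sub] by simp
  qed simp
  also have "\<dots> = (\<Sum>d\<in>reps_upto x. \<Sum>zs | zs \<in> ?L \<and> (\<forall>z\<in>set zs. d dvd z). moebius d)"
    by (rule sum.swap_restrict) (use fin in auto)
  also have "\<dots> = (\<Sum>d\<in>reps_upto x. moebius d * real (card (reps_upto (x / gnorm d))) ^ m)"
  proof (rule sum.cong)
    fix d assume "d \<in> reps_upto x"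
    then have d: "d \<in> gauss_reps" by (simp add: reps_upto_def)
    have "{zs. zs \<in> ?L \<and> (\<forall>z\<in>set zs. d dvd z)} =
        {zs. set zs \<subseteq> {z \<in> reps_upto x. d dvd z} \<and> length zs = m}" by auto
    then show "(\<Sum>zs | zs \<in> ?L \<and> (\<forall>z\<in>set zs. d dvd z). moebius d) =
        moebius d * real (card (reps_upto (x / gnorm d))) ^ m"
      using card_multiples[OF d, of x] by (simp add: card_lists_length_eq)
  qed simp
  finally show ?thesis .
qed

text \<open>Pairs of ideals with N(d) N(e) <= x are regrouped by their product k; from k and e the
  factor d is recovered by division.\<close>

lemma sum_pairs_eq_sum_divisors:
  fixes h :: "gauss \<Rightarrow> gauss \<Rightarrow> real"
  shows "(\<Sum>d\<in>reps_upto x. \<Sum>e\<in>reps_upto (x / gnorm d). h (normalize (d * e)) e) =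
    (\<Sum>k\<in>reps_upto x. \<Sum>e | normalize e = e \<and> e dvd k. h k e)"
proof -
  have fin: "finite {e. normalize e = e \<and> e dvd k}" if "k \<in> reps_upto x" for k
    using that by (intro finite_normalized_divisors) (auto simp: reps_upto_def gauss_reps_def)
  have "(\<Sum>d\<in>reps_upto x. \<Sum>e\<in>reps_upto (x / gnorm d). h (normalize (d * e)) e) =
      (\<Sum>(d, e)\<in>(SIGMA d:reps_upto x. reps_upto (x / gnorm d)). h (normalize (d * e)) e)"
    by (rule sum.Sigma) auto
  also have "\<dots> = (\<Sum>(k, e)\<in>(SIGMA k:reps_upto x. {e. normalize e = e \<and> e dvd k}). h k e)"
  proof (rule sum.reindex_bij_witness[where j = "\<lambda>(d, e). (normalize (d * e), e)"
        and i = "\<lambda>(k, e). (normalize (k div e), e)"])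
    fix p assume "p \<in> (SIGMA d:reps_upto x. reps_upto (x / gnorm d))"
    then obtain d e where p: "p = (d, e)" and d: "d \<in> reps_upto x" and e: "e \<in> reps_upto (x / gnorm d)"
      by (rule SigmaE)
    have nz: "d \<noteq> 0" "e \<noteq> 0" using d e by (auto simp: reps_upto_def gauss_reps_def)
    have "normalize (normalize (d * e) div e) = d"
      using d nz by (intro normalize_mult_div) (auto simp: reps_upto_def)
    then show "(\<lambda>(k, e). (normalize (k div e), e)) ((\<lambda>(d, e). (normalize (d * e), e)) p) = p"
      by (simp add: p)
    have "normalize (d * e) \<in> reps_upto x"
      using d e nz gnorm_pos[of d] by (auto simp: reps_upto_def gnorm_mult field_simps)
    moreover have "normalize e = e" "e dvd normalize (d * e)"
      using e by (auto simp: reps_upto_def gauss_reps_def)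
    ultimately show "(\<lambda>(d, e). (normalize (d * e), e)) p \<in>
        (SIGMA k:reps_upto x. {e. normalize e = e \<and> e dvd k})"
      by (simp add: p)
    show "(case (\<lambda>(d, e). (normalize (d * e), e)) p of (k, e) \<Rightarrow> h k e) =
        (case p of (d, e) \<Rightarrow> h (normalize (d * e)) e)"
      by (simp add: p)
  next
    fix p assume "p \<in> (SIGMA k:reps_upto x. {e. normalize e = e \<and> e dvd k})"
    then obtain k e where p: "p = (k, e)" and k: "k \<in> reps_upto x" and e: "normalize e = e" "e dvd k"
      by auto
    have nz: "k \<noteq> 0" "e \<noteq> 0" using k e by (auto simp: reps_upto_def gauss_reps_def)
    have le: "real (gnorm k) \<le> x" using k by (simp add: reps_upto_def)
    have div: "k div e \<noteq> 0" using nz e by (simp add: dvd_div_eq_0_iff)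
    have pos: "1 \<le> gnorm e" "1 \<le> gnorm (k div e)" using nz div gnorm_pos by blast+
    have "normalize (normalize (k div e) * e) = k"
      using k e by (intro normalize_div_mult) (auto simp: reps_upto_def)
    then show "(\<lambda>(d, e). (normalize (d * e), e)) ((\<lambda>(k, e). (normalize (k div e), e)) p) = p"
      by (simp add: p)
    have mult: "real (gnorm k) = real (gnorm (k div e)) * real (gnorm e)"
      using e(2) by (metis dvd_div_mult_self gnorm_mult of_nat_mult)
    then have "real (gnorm (k div e)) \<le> real (gnorm k)"
      using pos by (simp add: mult_le_cancel_left1)
    then have "normalize (k div e) \<in> reps_upto x"
      using le div by (simp add: reps_upto_def)
    moreover have "e \<in> reps_upto (x / gnorm (normalize (k div e)))"
      using le e nz pos mult by (simp add: reps_upto_def gauss_reps_def field_simps)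
    ultimately show "(\<lambda>(k, e). (normalize (k div e), e)) p \<in>
        (SIGMA d:reps_upto x. reps_upto (x / gnorm d))"
      by (simp add: p)
  qed
  also have "\<dots> = (\<Sum>k\<in>reps_upto x. \<Sum>e | normalize e = e \<and> e dvd k. h k e)"
    using fin by (intro sum.Sigma [symmetric]) auto
  finally show ?thesis .
qed

text \<open>Instead of sorting tuples by their gcd, this inverts
  \<open>visible_count_moebius\<close>: after regrouping by k = d e, the inner Moebius sum vanishes
  except at k = 1, which is in range as x >= 1.\<close>

lemma sum_visible_count:
  assumes "m > 0" "x \<ge> 1"
  shows "(\<Sum>d\<in>reps_upto x. real (visible_count gaussian_integers m (x / gnorm d))) =
    real (card (reps_upto x)) ^ m"
proof -
  have "(\<Sum>d\<in>reps_upto x. real (visible_count gaussian_integers m (x / gnorm d))) =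
    (\<Sum>d\<in>reps_upto x. \<Sum>e\<in>reps_upto (x / gnorm d).
      moebius e * real (card (reps_upto (x / gnorm (normalize (d * e))))) ^ m)"
    by (simp add: visible_count_moebius[OF assms(1)] gnorm_mult)
  also have "\<dots> = (\<Sum>k\<in>reps_upto x. \<Sum>e | normalize e = e \<and> e dvd k.
      moebius e * real (card (reps_upto (x / gnorm k))) ^ m)"
    by (rule sum_pairs_eq_sum_divisors)
  also have "\<dots> = (\<Sum>k\<in>reps_upto x. if k = 1 then real (card (reps_upto x)) ^ m else 0)"
  proof (rule sum.cong)
    fix k assume "k \<in> reps_upto x"
    then have k: "k \<in> gauss_reps" "k \<noteq> 0" by (auto simp: reps_upto_def gauss_reps_def)
    show "(\<Sum>e | normalize e = e \<and> e dvd k. moebius e * real (card (reps_upto (x / gnorm k))) ^ m) =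
        (if k = 1 then real (card (reps_upto x)) ^ m else 0)"
      using sum_moebius[OF k(2)] gauss_units_reps[OF k(1)] by (simp flip: sum_distrib_right)
  qed simp
  also have "\<dots> = real (card (reps_upto x)) ^ m"
  proof -
    have "1 \<in> reps_upto x" using assms(2) by (simp add: reps_upto_def gauss_reps_def)
    then show ?thesis by simp
  qed
  finally show ?thesis .
qed

subsection \<open>Asymptotics\<close>

lemma summable_on_product_nonneg:
  fixes f :: "'a \<Rightarrow> real" and g :: "'b \<Rightarrow> real"
  assumes "f summable_on A" "g summable_on B"
    "\<And>x. x \<in> A \<Longrightarrow> 0 \<le> f x" "\<And>y. y \<in> B \<Longrightarrow> 0 \<le> g y"
  shows "(\<lambda>(x, y). f x * g y) summable_on A \<times> B"
proof (rule summable_on_SigmaI)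
  show "((\<lambda>y. case (x, y) of (x, y) \<Rightarrow> f x * g y) has_sum f x * infsum g B) B" for x
    using has_sum_cmult_right[OF has_sum_infsum[OF assms(2)], of "f x"] by simp
  show "(\<lambda>x. f x * infsum g B) summable_on A"
    using assms(1) by (rule summable_on_cmult_left)
qed (use assms in auto)

text \<open>On the quadrant a > 0, b >= 0 the norm is at least a (b + 1), so the series is dominated
  by a product of two convergent p-series. The shift b + 1 keeps the factor nonzero on the axis b =
  0.\<close>

lemma summable_gnorm_powr:
  assumes "s > 1"
  shows "(\<lambda>z. real (gnorm z) powr - s) summable_on gauss_reps"
proof -
  have sum: "summable (\<lambda>n. real n powr - s)" using assms by (simp add: summable_real_powr_iff)
  then have f: "(\<lambda>n. real n powr - s) summable_on UNIV"
    by (intro norm_summable_imp_summable_on) simp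
  have g: "(\<lambda>n. real (Suc n) powr - s) summable_on UNIV"
    using sum summable_Suc_iff[of "\<lambda>n. real n powr - s"]
    by (intro norm_summable_imp_summable_on) simp
  define h where "h z = (nat (re z), nat (im z))" for z
  have inj: "inj_on h gauss_reps"
    by (rule inj_onI) (auto simp: h_def gauss_reps_iff gauss_eq_iff)
  have "(\<lambda>(m, n). real m powr - s * real (Suc n) powr - s) summable_on UNIV \<times> UNIV"
    by (rule summable_on_product_nonneg[OF f g]) auto
  then have "(\<lambda>(m, n). real m powr - s * real (Suc n) powr - s) summable_on h ` gauss_reps"
    by (rule summable_on_subset_banach) auto
  then have "((\<lambda>(m, n). real m powr - s * real (Suc n) powr - s) \<circ> h) summable_on gauss_reps"
    using summable_on_reindex[OF inj] by blast
  then show ?thesis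
  proof (rule summable_on_comparison_test)
    fix z assume z: "z \<in> gauss_reps"
    define a b where "a = re z" and "b = im z"
    have ab: "a > 0" "b \<ge> 0" using z by (auto simp: gauss_reps_iff a_def b_def)
    have "a * (b + 1) \<le> a\<^sup>2 + b\<^sup>2"
    proof (cases "b = 0")
      case True
      then show ?thesis using ab by (simp add: power2_eq_square)
    next
      \<comment> \<open>The two nonnegative terms come from 4 (a^2 + b^2 - a (b + 1)) = (2 a - b -
        1)^2 + (3 b + 1) (b - 1).\<close>
      case False
      then have "0 \<le> (3 * b + 1) * (b - 1)" using ab by simp
      moreover have "0 \<le> (2 * a - b - 1)\<^sup>2" by simp
      ultimately show ?thesis by (simp add: power2_eq_square algebra_simps)
    qed
    then have "real_of_int (a * (b + 1)) \<le> real_of_int (int (gnorm z))"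
      unfolding int_gnorm a_def [symmetric] b_def [symmetric] by (simp only: of_int_le_iff)
    then have le: "real (nat a) * real (Suc (nat b)) \<le> real (gnorm z)"
      using ab by (simp add: algebra_simps)
    have "real (gnorm z) powr - s \<le> (real (nat a) * real (Suc (nat b))) powr - s"
      using le ab assms by (intro powr_mono2') auto
    also have "\<dots> = real (nat a) powr - s * real (Suc (nat b)) powr - s"
      by (rule powr_mult)
    finally show "real (gnorm z) powr - s \<le> ((\<lambda>(m, n). real m powr - s * real (Suc n) powr - s) \<circ> h) z"
      by (simp add: h_def a_def b_def)
  qed simp
qed

lemma dedekind_zeta_eq:
  "dedekind_zeta gaussian_integers s = (\<Sum>\<^sub>\<infinity>z\<in>gauss_reps. real (gnorm z) powr - s)"
proof -
  have "dedekind_zeta gaussian_integers s =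
      (\<Sum>\<^sub>\<infinity>z\<in>gauss_reps. real (ideal_norm gaussian_integers (gideal z)) powr - s)"
    unfolding dedekind_zeta_def by (rule infsum_reindex_bij_betw [symmetric, OF bij_betw_gideal])
  also have "\<dots> = (\<Sum>\<^sub>\<infinity>z\<in>gauss_reps. real (gnorm z) powr - s)"
    by (rule infsum_cong) (simp add: ideal_norm_gideal gauss_reps_nonzero)
  finally show ?thesis .
qed

lemma summable_weighted:
  fixes w :: "gauss \<Rightarrow> real"
  assumes "s > 1" "\<And>z. \<bar>w z\<bar> \<le> 1"
  shows "(\<lambda>z. w z * real (gnorm z) powr - s) summable_on gauss_reps"
proof (rule abs_summable_summable, rule summable_on_comparison_test)
  show "(\<lambda>z. real (gnorm z) powr - s) summable_on gauss_reps"
    using assms(1) by (rule summable_gnorm_powr)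
  show "norm (w z * real (gnorm z) powr - s) \<le> real (gnorm z) powr - s" for z
    using assms(2)[of z] by (simp add: abs_mult mult_left_le_one_le)
qed simp

lemma bij_betw_normalize_mult:
  "bij_betw (\<lambda>(d, e). (normalize (d * e), e)) (gauss_reps \<times> gauss_reps)
    (SIGMA k:gauss_reps. {e. normalize e = e \<and> e dvd k})"
proof (rule bij_betw_byWitness[where f' = "\<lambda>(k, e). (normalize (k div e), e)"])
  show "\<forall>p\<in>gauss_reps \<times> gauss_reps. (\<lambda>(k, e). (normalize (k div e), e))
      ((\<lambda>(d, e). (normalize (d * e), e)) p) = p"
    using normalize_mult_div by (auto simp: gauss_reps_nonzero)
  show "\<forall>p\<in>(SIGMA k:gauss_reps. {e. normalize e = e \<and> e dvd k}).
      (\<lambda>(d, e). (normalize (d * e), e)) ((\<lambda>(k, e). (normalize (k div e), e)) p) = p"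
    using normalize_div_mult by auto
  show "(\<lambda>(d, e). (normalize (d * e), e)) ` (gauss_reps \<times> gauss_reps)
      \<subseteq> (SIGMA k:gauss_reps. {e. normalize e = e \<and> e dvd k})"
    by (auto simp: gauss_reps_nonzero) (auto simp: gauss_reps_def)
  show "(\<lambda>(k, e). (normalize (k div e), e)) ` (SIGMA k:gauss_reps. {e. normalize e = e \<and> e dvd k})
      \<subseteq> gauss_reps \<times> gauss_reps"
    by (auto simp: gauss_reps_nonzero dvd_div_eq_0_iff) (auto simp: gauss_reps_def)
qed

text \<open>A Dirichlet product, regrouped by k = d e so that \<open>sum_moebius\<close> leaves only
  k = 1; absolute convergence on the product set justifies the rearrangement. It identifies the
  constant 1 / zeta(m) and shows that zeta(m) is nonzero.\<close>

lemma zeta_times_moebius_sum: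
  assumes "s > 1"
  shows "dedekind_zeta gaussian_integers s *
    (\<Sum>\<^sub>\<infinity>e\<in>gauss_reps. moebius e * real (gnorm e) powr - s) = 1"
proof -
  let ?n = "\<lambda>z. real (gnorm z) powr - s"
  let ?f = "\<lambda>(d, e). ?n d * (moebius e * ?n e)"
  let ?S = "SIGMA k:gauss_reps. {e. normalize e = e \<and> e dvd k}"
  have "(\<lambda>(d, e). ?n d * ?n e) summable_on gauss_reps \<times> gauss_reps"
    by (rule summable_on_product_nonneg[OF summable_gnorm_powr[OF assms] summable_gnorm_powr[OF assms]])
       auto
  then have "(\<lambda>p. norm (?f p)) summable_on gauss_reps \<times> gauss_reps"
    by (rule summable_on_comparison_test)
       (use abs_moebius_le in \<open>auto simp: abs_mult intro!: mult_left_mono mult_left_le_one_le\<close>)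
  then have sum: "?f summable_on gauss_reps \<times> gauss_reps" by (rule abs_summable_summable)
  have sumS: "(\<lambda>(k, e). ?n k * moebius e) summable_on ?S"
    and eq: "infsum (\<lambda>(k, e). ?n k * moebius e) ?S = infsum ?f (gauss_reps \<times> gauss_reps)"
  proof -
    have *: "(\<lambda>(k, e). ?n k * moebius e) ((\<lambda>(d, e). (normalize (d * e), e)) p) = ?f p" for p
      by (cases p) (simp add: gnorm_mult powr_mult)
    show "(\<lambda>(k, e). ?n k * moebius e) summable_on ?S"
      using sum unfolding * [symmetric] summable_on_reindex_bij_betw[OF bij_betw_normalize_mult] .
    show "infsum (\<lambda>(k, e). ?n k * moebius e) ?S = infsum ?f (gauss_reps \<times> gauss_reps)"
      using infsum_reindex_bij_betw[OF bij_betw_normalize_mult, of "\<lambda>(k, e). ?n k * moebius e"]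
      unfolding * by simp
  qed
  have "dedekind_zeta gaussian_integers s * (\<Sum>\<^sub>\<infinity>e\<in>gauss_reps. moebius e * ?n e) =
      (\<Sum>\<^sub>\<infinity>d\<in>gauss_reps. \<Sum>\<^sub>\<infinity>e\<in>gauss_reps. ?n d * (moebius e * ?n e))"
    unfolding dedekind_zeta_eq by (simp add: infsum_cmult_right' infsum_cmult_left')
  also have "\<dots> = infsum ?f (gauss_reps \<times> gauss_reps)"
    by (rule infsum_Sigma'_banach[OF sum])
  also have "\<dots> = (\<Sum>\<^sub>\<infinity>k\<in>gauss_reps. \<Sum>\<^sub>\<infinity>e | normalize e = e \<and> e dvd k. ?n k * moebius e)"
    unfolding eq [symmetric] by (rule infsum_Sigma'_banach [symmetric, OF sumS])
  also have "\<dots> = (\<Sum>\<^sub>\<infinity>k\<in>gauss_reps. if k = 1 then 1 else 0)"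
  proof (rule infsum_cong)
    fix k assume k: "k \<in> gauss_reps"
    then have k0: "k \<noteq> 0" by (rule gauss_reps_nonzero)
    have "(\<Sum>\<^sub>\<infinity>e | normalize e = e \<and> e dvd k. ?n k * moebius e) =
        ?n k * (\<Sum>e | normalize e = e \<and> e dvd k. moebius e)"
      using finite_normalized_divisors[OF k0] by (simp add: sum_distrib_left)
    then show "(\<Sum>\<^sub>\<infinity>e | normalize e = e \<and> e dvd k. ?n k * moebius e) = (if k = 1 then 1 else 0)"
      using sum_moebius[OF k0] gauss_units_reps[OF k] by simp
  qed
  also have "\<dots> = (\<Sum>\<^sub>\<infinity>k\<in>{1 :: gauss}. 1)"
    by (rule infsum_cong_neutral) (auto simp: gauss_reps_def)
  finally show ?thesis by simp
qed

text \<open>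
  The weights \<open>moebius\<close> and \<open>1\<close> give the two directions of the theorem: they express the visible
  tuples in terms of all tuples, and conversely.
\<close>

lemma weighted_sum_asymp:
  fixes w :: "gauss \<Rightarrow> real" and H :: "real \<Rightarrow> real"
  assumes w: "\<And>z. \<bar>w z\<bar> \<le> 1" and b: "1 < b" "b \<le> real m"
    and H: "\<And>y. y \<ge> 1 \<Longrightarrow> \<bar>H y - A * y ^ m\<bar> \<le> K * y powr b" and x: "x \<ge> 1"
  shows "\<bar>(\<Sum>d\<in>reps_upto x. w d * H (x / gnorm d)) -
      A * x ^ m * (\<Sum>\<^sub>\<infinity>d\<in>gauss_reps. w d * real (gnorm d) powr - real m)\<bar>
    \<le> ((K + \<bar>A\<bar>) * dedekind_zeta gaussian_integers b) * x powr b"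
proof -
  let ?n = "\<lambda>z. real (gnorm z)"
  \<comment> \<open>Extending the finite sum by zero allows a termwise comparison with the main-term
    series over the same index set.\<close>
  define f where "f d = (if d \<in> reps_upto x then w d * H (x / ?n d) else 0)" for d
  define g where "g d = (A * x ^ m) * (w d * ?n d powr - real m)" for d
  have K: "K \<ge> 0" using H[of 1] by simp
  have m1: "real m > 1" using b by simp
  have fsum: "f summable_on gauss_reps"
    by (rule summable_on_cong_neutral [THEN iffD1, OF _ _ _ summable_on_finite[OF finite_reps_upto[of x], of f]])
       (use reps_upto_subset in \<open>auto simp: f_def\<close>)
  have gsum: "g summable_on gauss_reps"
    unfolding g_def by (intro summable_on_cmult_right summable_weighted m1 w)
  have "infsum f gauss_reps = (\<Sum>\<^sub>\<infinity>d\<in>reps_upto x. w d * H (x / ?n d))"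
    by (rule infsum_cong_neutral) (use reps_upto_subset in \<open>auto simp: f_def\<close>)
  then have finf: "infsum f gauss_reps = (\<Sum>d\<in>reps_upto x. w d * H (x / ?n d))" by simp
  have ginf: "infsum g gauss_reps = A * x ^ m * (\<Sum>\<^sub>\<infinity>d\<in>gauss_reps. w d * ?n d powr - real m)"
    unfolding g_def by (rule infsum_cmult_right')
  \<comment> \<open>With y = x / N(d) each difference is at most (K + |A|) y^b. Summing N(d)^(-b),
    which converges as b > 1, gives the factor zeta(b).\<close>
  have bound: "\<bar>f d - g d\<bar> \<le> ((K + \<bar>A\<bar>) * x powr b) * ?n d powr - b" if d: "d \<in> gauss_reps" for d
  proof -
    have n: "?n d \<ge> 1" using d gnorm_pos[of d] by (simp add: gauss_reps_nonzero)
    define y where "y = x / ?n d"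
    have y: "y > 0" using n x by (simp add: y_def)
    have g: "g d = w d * (A * y ^ m)"
      using n by (simp add: g_def y_def powr_minus powr_realpow power_divide field_simps)
    have yb: "x powr b * ?n d powr - b = y powr b"
      using n x by (simp add: y_def powr_divide powr_minus field_simps)
    have "\<bar>f d - g d\<bar> \<le> (K + \<bar>A\<bar>) * y powr b"
    proof (cases "d \<in> reps_upto x")
      case True
      then have "y \<ge> 1" using n by (simp add: y_def reps_upto_def)
      have "\<bar>f d - g d\<bar> = \<bar>w d\<bar> * \<bar>H y - A * y ^ m\<bar>"
        using True unfolding g f_def y_def [symmetric] by (simp add: abs_mult [symmetric] algebra_simps)
      also have "\<dots> \<le> 1 * (K * y powr b)"
        by (intro mult_mono w H \<open>y \<ge> 1\<close>) auto
      also have "\<dots> \<le> (K + \<bar>A\<bar>) * y powr b" by (simp add: algebra_simps)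
      finally show ?thesis .
    next
      \<comment> \<open>In the tail only the main term remains, and y <= 1 with b <= m gives y^m <=
        y^b; this accounts for |A| in the constant.\<close>
      case False
      then have "y \<le> 1" using n d by (simp add: y_def reps_upto_def)
      have "\<bar>f d - g d\<bar> = \<bar>w d\<bar> * (\<bar>A\<bar> * y powr real m)"
        using False y by (simp add: g f_def abs_mult powr_realpow)
      also have "\<dots> \<le> 1 * (\<bar>A\<bar> * y powr b)"
        using b y \<open>y \<le> 1\<close> by (intro mult_mono w powr_mono') auto
      also have "\<dots> \<le> (K + \<bar>A\<bar>) * y powr b" using K by (simp add: algebra_simps)
      finally show ?thesis .
    qed
    then show ?thesis unfolding yb [symmetric] by (simp only: mult.assoc)
  qed
  have "((\<lambda>d. - g d) has_sum - infsum g gauss_reps) gauss_reps"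
    using has_sum_infsum[OF gsum] by (simp add: has_sum_uminus)
  then have "((\<lambda>d. f d + - g d) has_sum (infsum f gauss_reps + - infsum g gauss_reps)) gauss_reps"
    by (rule has_sum_add[OF has_sum_infsum[OF fsum]])
  moreover have "((\<lambda>d. ((K + \<bar>A\<bar>) * x powr b) * ?n d powr - b) has_sum
      (\<Sum>\<^sub>\<infinity>d\<in>gauss_reps. ((K + \<bar>A\<bar>) * x powr b) * ?n d powr - b)) gauss_reps"
    by (intro has_sum_infsum summable_on_cmult_right summable_gnorm_powr b)
  ultimately have "norm (infsum f gauss_reps + - infsum g gauss_reps) \<le>
      (\<Sum>\<^sub>\<infinity>d\<in>gauss_reps. ((K + \<bar>A\<bar>) * x powr b) * ?n d powr - b)"
    by (rule norm_infsum_le) (use bound in simp)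
  then have "\<bar>infsum f gauss_reps - infsum g gauss_reps\<bar> \<le>
      (\<Sum>\<^sub>\<infinity>d\<in>gauss_reps. ((K + \<bar>A\<bar>) * x powr b) * ?n d powr - b)" by simp
  also have "\<dots> = ((K + \<bar>A\<bar>) * dedekind_zeta gaussian_integers b) * x powr b"
    unfolding dedekind_zeta_eq infsum_cmult_right' by simp
  finally show ?thesis unfolding finf ginf .
qed

section \<open>Transfer between the two error terms\<close>

lemma abs_power_diff_le:
  fixes a b :: real
  assumes "\<bar>a\<bar> \<le> B" "\<bar>b\<bar> \<le> B"
  shows "\<bar>a ^ m - b ^ m\<bar> \<le> \<bar>a - b\<bar> * (real m * B ^ (m - 1))"
proof -
  have B: "0 \<le> B" using assms(1) by linarith
  have "\<bar>b ^ (m - Suc i) * a ^ i\<bar> \<le> B ^ (m - 1)" if "i < m" for i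
  proof -
    have "\<bar>b ^ (m - Suc i) * a ^ i\<bar> \<le> B ^ (m - Suc i) * B ^ i"
      unfolding abs_mult power_abs using assms B by (intro mult_mono power_mono) simp_all
    also have "\<dots> = B ^ (m - 1)" using that by (simp flip: power_add)
    finally show ?thesis .
  qed
  then have "\<bar>\<Sum>i<m. b ^ (m - Suc i) * a ^ i\<bar> \<le> real m * B ^ (m - 1)"
    using sum_norm_le[of "{..<m}" "\<lambda>i. b ^ (m - Suc i) * a ^ i" "\<lambda>_. B ^ (m - 1)"] by simp
  then show ?thesis
    unfolding power_diff_sumr2 abs_mult by (rule mult_left_mono) simp
qed

text \<open>Beyond the threshold R the big-O constant works; on [1, R] the function is bounded by
  some B, and g >= 1 turns this into a multiple of g.\<close>

lemma bigo_at_top_imp_bound: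
  fixes f g :: "real \<Rightarrow> real"
  assumes "f \<in> O[at_top](g)" and bd: "\<And>R. \<exists>B. \<forall>y\<in>{1..R}. \<bar>f y\<bar> \<le> B"
    and g: "\<And>y. y \<ge> 1 \<Longrightarrow> g y \<ge> 1"
  obtains K where "K \<ge> 0" "\<And>y. y \<ge> 1 \<Longrightarrow> \<bar>f y\<bar> \<le> K * g y"
proof -
  obtain c where "c > 0" "eventually (\<lambda>y. norm (f y) \<le> c * norm (g y)) at_top"
    using assms(1) by (rule landau_o.bigE)
  then obtain R where R: "\<And>y. y \<ge> R \<Longrightarrow> \<bar>f y\<bar> \<le> c * \<bar>g y\<bar>"
    by (auto simp: eventually_at_top_linorder)
  obtain B where B: "\<And>y. y \<in> {1..R} \<Longrightarrow> \<bar>f y\<bar> \<le> B" using bd[of R] by blast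
  show thesis
  proof (rule that)
    show "max c B \<ge> 0" using \<open>c > 0\<close> by simp
    fix y :: real assume y: "y \<ge> 1"
    show "\<bar>f y\<bar> \<le> max c B * g y"
    proof (cases "y \<ge> R")
      case True
      then have "\<bar>f y\<bar> \<le> c * g y" using R[OF True] g[OF y] by simp
      also have "\<dots> \<le> max c B * g y" using g[OF y] by (intro mult_right_mono) auto
      finally show ?thesis .
    next
      case False
      then have "\<bar>f y\<bar> \<le> max c B * 1" using B[of y] y by simp
      also have "\<dots> \<le> max c B * g y" using g[OF y] \<open>c > 0\<close> by (intro mult_left_mono) auto
      finally show ?thesis .
    qed
  qed
qed

lemma reps_upto_mono: "x \<le> y \<Longrightarrow> reps_upto x \<subseteq> reps_upto y"
  by (auto simp: reps_upto_def)

lemma visible_count_mono: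
  assumes "x \<le> y"
  shows "visible_count gaussian_integers m x \<le> visible_count gaussian_integers m y"
  unfolding visible_count_eq using reps_upto_mono[OF assms]
  by (intro card_mono finite_visible_reps) (auto simp: visible_reps_def)

text \<open>Since a < 1, both I(y) and c y are at most (c + K) y, so factoring a difference of m-th
  powers bounds I(y)^m - (c y)^m by O(y^a) times O(y^(m-1)). The Moebius-weighted sum preserves this
  exponent.\<close>

lemma ideal_count_bound_imp_visible_bound:
  assumes a: "0 < a" "a < 1" and m: "m \<ge> 2" and c: "c \<ge> 0" and K: "K \<ge> 0"
    and I: "\<And>y. y \<ge> 1 \<Longrightarrow> \<bar>real (card (reps_upto y)) - c * y\<bar> \<le> K * y powr a"
  obtains C where "\<And>x. x \<ge> 1 \<Longrightarrow>
    \<bar>real (visible_count gaussian_integers m x) - (c * x) ^ m / dedekind_zeta gaussian_integers (real m)\<bar>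
      \<le> C * x powr (real m - 1 + a)"
proof -
  define Z where "Z = dedekind_zeta gaussian_integers (real m)"
  define L where "L = K * (real m * (c + K) ^ (m - 1))"
  have "\<bar>real (card (reps_upto y)) ^ m - c ^ m * y ^ m\<bar> \<le> L * y powr (real m - 1 + a)" if y: "y \<ge> 1" for y
  proof -
    have "y powr a \<le> y powr 1" using a y by (intro powr_mono) auto
    then have "K * y powr a \<le> K * y" using K y by (intro mult_left_mono) auto
    then have B: "\<bar>real (card (reps_upto y))\<bar> \<le> (c + K) * y" "\<bar>c * y\<bar> \<le> (c + K) * y"
      using I[OF y] c K y by (auto simp: algebra_simps)
    have "\<bar>real (card (reps_upto y)) ^ m - (c * y) ^ m\<bar>
        \<le> \<bar>real (card (reps_upto y)) - c * y\<bar> * (real m * ((c + K) * y) ^ (m - 1))"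
      by (rule abs_power_diff_le[OF B])
    also have "\<dots> \<le> (K * y powr a) * (real m * ((c + K) * y) ^ (m - 1))"
      using I[OF y] c K y by (intro mult_right_mono) auto
    also have "y ^ (m - 1) = y powr (real m - 1)"
      using y m powr_realpow[of y "m - 1"] by (simp add: of_nat_diff)
    then have "(K * y powr a) * (real m * ((c + K) * y) ^ (m - 1)) = L * y powr (real m - 1 + a)"
      by (simp add: L_def power_mult_distrib powr_add)
    finally show ?thesis by (simp add: power_mult_distrib)
  qed
  then have "\<bar>(\<Sum>d\<in>reps_upto x. moebius d * real (card (reps_upto (x / gnorm d))) ^ m) -
      c ^ m * x ^ m * (\<Sum>\<^sub>\<infinity>d\<in>gauss_reps. moebius d * real (gnorm d) powr - real m)\<bar>
      \<le> ((L + \<bar>c ^ m\<bar>) * dedekind_zeta gaussian_integers (real m - 1 + a)) * x powr (real m - 1 + a)"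
    if "x \<ge> 1" for x
    using m a that by (intro weighted_sum_asymp abs_moebius_le) auto
  moreover have "(\<Sum>\<^sub>\<infinity>d\<in>gauss_reps. moebius d * real (gnorm d) powr - real m) = 1 / Z"
    using zeta_times_moebius_sum[of "real m"] m unfolding Z_def by (intro eq_divide_imp) (auto simp: mult.commute)
  ultimately show thesis
    using m by (intro that[of "(L + \<bar>c ^ m\<bar>) * dedekind_zeta gaussian_integers (real m - 1 + a)"])
      (auto simp: visible_count_moebius Z_def power_mult_distrib)
qed

text \<open>The weights 1 give a bound for n^m - (c x)^m, where n = I(x). Its factor complementary
  to n - c x is at least (c x)^(m-1), so dividing it out lowers the exponent by the full m -
  1.\<close>

lemma visible_bound_imp_ideal_count_bound:
  assumes m: "m \<ge> 2" and a: "0 < a" "a < 1" and c: "c > 0"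
    and V: "\<And>x. x \<ge> 1 \<Longrightarrow>
      \<bar>real (visible_count gaussian_integers m x) - (c * x) ^ m / dedekind_zeta gaussian_integers (real m)\<bar>
      \<le> K * x powr (real m - 1 + a)"
  obtains C where "\<And>x. x \<ge> 1 \<Longrightarrow> \<bar>real (card (reps_upto x)) - c * x\<bar> \<le> C * x powr a"
proof -
  define Z where "Z = dedekind_zeta gaussian_integers (real m)"
  have Z: "Z \<noteq> 0" using zeta_times_moebius_sum[of "real m"] m unfolding Z_def by auto
  define C where "C = (K + \<bar>c ^ m / Z\<bar>) * dedekind_zeta gaussian_integers (real m - 1 + a)"
  show thesis
  proof (rule that)
    fix x :: real assume x: "x \<ge> 1"
    define n where "n = real (card (reps_upto x))"
    \<comment> \<open>The weighted series is now Z itself, cancelling the denominator of A = c^m /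
      Z, and the finite sum is n^m.\<close>
    have "\<bar>(\<Sum>d\<in>reps_upto x. 1 * real (visible_count gaussian_integers m (x / gnorm d))) -
        c ^ m / Z * x ^ m * (\<Sum>\<^sub>\<infinity>d\<in>gauss_reps. 1 * real (gnorm d) powr - real m)\<bar>
      \<le> C * x powr (real m - 1 + a)"
      unfolding C_def using m a x V by (intro weighted_sum_asymp) (auto simp: power_mult_distrib Z_def)
    then have "\<bar>n ^ m - c ^ m * x ^ m\<bar> \<le> C * x powr (real m - 1 + a)"
      using Z x m by (simp add: sum_visible_count dedekind_zeta_eq Z_def n_def)
    then have le: "\<bar>n ^ m - (c * x) ^ m\<bar> \<le> C * x powr (real m - 1 + a)"
      by (simp add: power_mult_distrib)
    \<comment> \<open>All summands are nonnegative, so the one with i = 0 is a lower bound.\<close>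
    have "(c * x) ^ (m - 1) \<le> (\<Sum>i<m. (c * x) ^ (m - Suc i) * n ^ i)"
    proof -
      have "(c * x) ^ (m - 1) = (\<Sum>i\<in>{0}. (c * x) ^ (m - Suc i) * n ^ i)" by simp
      also have "\<dots> \<le> (\<Sum>i<m. (c * x) ^ (m - Suc i) * n ^ i)"
        using m c x by (intro sum_mono2) (auto simp: n_def)
      finally show ?thesis .
    qed
    then have "\<bar>n - c * x\<bar> * (c * x) ^ (m - 1) \<le> \<bar>n ^ m - (c * x) ^ m\<bar>"
      unfolding power_diff_sumr2 abs_mult by (intro mult_left_mono) auto
    also have "\<dots> \<le> C * x powr (real m - 1 + a)" by (rule le)
    also have "\<dots> = (C / c ^ (m - 1) * x powr a) * (c * x) ^ (m - 1)"
    proof -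
      have "x ^ (m - 1) = x powr (real m - 1)"
        using x m powr_realpow[of x "m - 1"] by (simp add: of_nat_diff)
      then show ?thesis using c by (simp add: power_mult_distrib powr_add)
    qed
    finally show "\<bar>real (card (reps_upto x)) - c * x\<bar> \<le> C / c ^ (m - 1) * x powr a"
      unfolding n_def by (rule mult_right_le_imp_le) (use c x in simp)
  qed
qed

theorem theorem5p1:
  fixes \<alpha> :: real
  assumes "1 / 4 < \<alpha>" and "\<alpha> < 1 / 3"
  shows "(\<lambda>r. real (circle_count r) - pi * r) \<in> O[at_top](\<lambda>r. r powr \<alpha>) \<longleftrightarrow>
    (\<forall>m\<ge>2. visible_error m \<in> O[at_top](\<lambda>x.
       if m \<ge> 3 then x powr (real m - 1 + \<alpha>) else x powr (1 + \<alpha>) * ln x))"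
proof
  assume *: "(\<lambda>r. real (circle_count r) - pi * r) \<in> O[at_top](\<lambda>r. r powr \<alpha>)"
  \<comment> \<open>On a bounded interval monotonicity of the count in y suffices.\<close>
  have bd: "\<exists>B. \<forall>y\<in>{1..R}. \<bar>real (circle_count y) - pi * y\<bar> \<le> B" for R
  proof (intro exI ballI)
    fix y assume y: "y \<in> {1..R}"
    have "real (card (reps_upto y)) \<le> real (card (reps_upto R))"
      using y by (simp add: card_mono reps_upto_mono)
    moreover have "pi * y \<le> pi * R" "pi * y \<ge> 0" using y by auto
    ultimately show "\<bar>real (circle_count y) - pi * y\<bar> \<le> 4 * real (card (reps_upto R)) + 1 + pi * R"
      using y circle_count_eq[of y] unfolding atLeastAtMost_iff by linarith
  qed
  have "1 \<le> y powr \<alpha>" if "y \<ge> 1" for y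
    using that assms by (intro ge_one_powr_ge_zero) auto
  then obtain K where K: "K \<ge> 0" "\<And>y. y \<ge> 1 \<Longrightarrow> \<bar>real (circle_count y) - pi * y\<bar> \<le> K * y powr \<alpha>"
    using bigo_at_top_imp_bound[OF * bd] by blast
  \<comment> \<open>Division by the four units turns \<pi> into the density \<pi> / 4; the extra 1
    in K + 1 absorbs the origin.\<close>
  have I: "\<bar>real (card (reps_upto y)) - pi / 4 * y\<bar> \<le> (K + 1) * y powr \<alpha>" if y: "y \<ge> 1" for y
  proof -
    have "1 \<le> y powr \<alpha>" using y assms by (intro ge_one_powr_ge_zero) auto
    then show ?thesis using K(2)[OF y] circle_count_eq[of y] y by (simp add: algebra_simps)
  qed
  show "\<forall>m\<ge>2. visible_error m \<in> O[at_top](\<lambda>x.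
       if m \<ge> 3 then x powr (real m - 1 + \<alpha>) else x powr (1 + \<alpha>) * ln x)"
  proof (intro allI impI)
    fix m :: nat assume m: "m \<ge> 2"
    obtain C where C: "\<And>x. x \<ge> 1 \<Longrightarrow>
      \<bar>real (visible_count gaussian_integers m x) - (pi / 4 * x) ^ m / dedekind_zeta gaussian_integers (real m)\<bar>
      \<le> C * x powr (real m - 1 + \<alpha>)"
      using ideal_count_bound_imp_visible_bound[OF _ _ m _ _ I] assms K(1) by auto
    have 1: "visible_error m \<in> O[at_top](\<lambda>x. x powr (real m - 1 + \<alpha>))"
    proof (rule bigoI[of _ C], rule eventually_mono[OF eventually_ge_at_top[of 1]])
      fix x :: real assume "x \<ge> 1"
      then show "norm (visible_error m x) \<le> C * norm (x powr (real m - 1 + \<alpha>))"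
        using C[of x] by (simp add: visible_error_def)
    qed
    show "visible_error m \<in> O[at_top](\<lambda>x. if m \<ge> 3 then x powr (real m - 1 + \<alpha>) else x powr (1 + \<alpha>) * ln x)"
    proof (cases "m \<ge> 3")
      case False
      then have "m = 2" using m by simp
      \<comment> \<open>The bound without logarithm is the stronger one, since ln x >= 1 from e
        onwards.\<close>
      have "(\<lambda>x. x powr (1 + \<alpha>)) \<in> O[at_top](\<lambda>x. x powr (1 + \<alpha>) * ln x)"
      proof (rule bigoI[of _ 1], rule eventually_mono[OF eventually_ge_at_top[of "exp 1"]])
        fix x :: real assume "x \<ge> exp 1"
        then have "ln x \<ge> 1" by (smt (verit) exp_gt_zero ln_exp ln_le_cancel_iff)
        then show "norm (x powr (1 + \<alpha>)) \<le> 1 * norm (x powr (1 + \<alpha>) * ln x)"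
          by (simp add: mult_le_cancel_left1)
      qed
      with 1 show ?thesis unfolding \<open>m = 2\<close> by (auto intro: landau_o.big_trans)
    qed (use 1 in simp)
  qed
next
  assume *: "\<forall>m\<ge>2. visible_error m \<in> O[at_top](\<lambda>x.
       if m \<ge> 3 then x powr (real m - 1 + \<alpha>) else x powr (1 + \<alpha>) * ln x)"
  define Z where "Z = dedekind_zeta gaussian_integers 3"
  \<comment> \<open>The least m whose hypothesis carries no logarithm; for m = 2 the same argument
    would leave a factor ln x in the bound for the circle problem.\<close>
  have 3: "visible_error 3 \<in> O[at_top](\<lambda>x. x powr (2 + \<alpha>))"
    using *[rule_format, of 3] by simp
  have bd: "\<exists>B. \<forall>y\<in>{1..R}. \<bar>visible_error 3 y\<bar> \<le> B" for R
  proof (intro exI ballI)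
    fix y assume y: "y \<in> {1..R}"
    have "\<bar>(pi * y / 4) ^ 3 / Z\<bar> = (pi * y / 4) ^ 3 / \<bar>Z\<bar>" using y by (simp add: abs_divide)
    also have "\<dots> \<le> (pi * R / 4) ^ 3 / \<bar>Z\<bar>"
      using y by (intro divide_right_mono power_mono) auto
    finally have "\<bar>(pi * y / 4) ^ 3 / Z\<bar> \<le> (pi * R / 4) ^ 3 / \<bar>Z\<bar>" .
    moreover have "real (visible_count gaussian_integers 3 y) \<le> real (visible_count gaussian_integers 3 R)"
      using visible_count_mono[of y R 3] y by simp
    moreover have "visible_error 3 y = real (visible_count gaussian_integers 3 y) - (pi * y / 4) ^ 3 / Z"
      by (simp add: visible_error_def Z_def)
    ultimately show "\<bar>visible_error 3 y\<bar> \<le>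
        real (visible_count gaussian_integers 3 R) + (pi * R / 4) ^ 3 / \<bar>Z\<bar>" by linarith
  qed
  have "1 \<le> y powr (2 + \<alpha>)" if "y \<ge> 1" for y
    using that assms by (intro ge_one_powr_ge_zero) auto
  then obtain K where K: "\<And>y. y \<ge> 1 \<Longrightarrow> \<bar>visible_error 3 y\<bar> \<le> K * y powr (2 + \<alpha>)"
    using bigo_at_top_imp_bound[OF 3 bd] by blast
  obtain C where C: "\<And>x. x \<ge> 1 \<Longrightarrow> \<bar>real (card (reps_upto x)) - pi / 4 * x\<bar> \<le> C * x powr \<alpha>"
    using visible_bound_imp_ideal_count_bound[of 3 \<alpha> "pi / 4" K] assms K
    by (auto simp: visible_error_def)
  show "(\<lambda>r. real (circle_count r) - pi * r) \<in> O[at_top](\<lambda>r. r powr \<alpha>)"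
  proof (rule bigoI[of _ "4 * C + 1"], rule eventually_mono[OF eventually_ge_at_top[of 1]])
    \<comment> \<open>In 4 * C + 1 the 4 counts the units and the 1 pays for the origin.\<close>
    fix x :: real assume x: "x \<ge> 1"
    have "1 \<le> x powr \<alpha>" using x assms by (intro ge_one_powr_ge_zero) auto
    then show "norm (real (circle_count x) - pi * x) \<le> (4 * C + 1) * norm (x powr \<alpha>)"
      using C[OF x] circle_count_eq[of x] x by (simp add: algebra_simps abs_if split: if_splits)
  qed
qed

end
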